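(* Let $A$ be a positive definite symmetric $n\times n$ matrix with $\det A=1$, and set $\Gamma:=A^{1/2}\mathbb{Z}^n$. For each $p\in\operatorname{vert}(\operatorname{Vor}_\Gamma)$ and each $x\in\operatorname{Del}_\Gamma(p)$, define $$w(x):=\tfrac12|\xi|^2+p\cdot(x-\xi),$$ where $\xi\in\Gamma$ is any point such that $p\in\operatorname{Vor}_\Gamma(\xi)$. Here the admissible $\xi$ are precisely the vertices of $\operatorname{Del}_\Gamma(p)$, and the right-hand side is independent of the choice of $\xi$. Then, up to an additive constant, the function $u(x):=w(A^{1/2}x)$ is the unique global convex (Alexandrov) solution of $$\det D^2u=\sum_{z\in\mathbb{Z}^n}\delta_z\quad\text{in }\mathbb{R}^n$$ with quadratic part $\frac12x^{\top}Ax$.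
   Context: $\delta_z$ is the Dirac mass at $z$. A convex function $u$ on $\mathbb{R}^n$ is an Alexandrov solution of $\det D^2u=\mu$ if $|\partial u(E)|=\mu(E)$ for all Borel $E$, where $\partial u$ is the subdifferential. A solution $u$ has quadratic part $\frac12x^{\top}Ax$ if $u(x)-\frac12x^{\top}Ax$ is $\mathbb{Z}^n$-periodic. For an $n$-dimensional lattice $\Gamma$ and $\xi\in\Gamma$, the Dirichlet-Voronoi polytope is $\operatorname{Vor}_\Gamma(\xi)=\{x\in\mathbb{R}^n:|x-\xi|\le|x-\tilde\xi|\ \ \forall\tilde\xi\in\Gamma\}$; $\operatorname{vert}(\operatorname{Vor}_\Gamma)=\bigcup_{\xi\in\Gamma}\operatorname{vert}(\operatorname{Vor}_\Gamma(\xi))$, where $\operatorname{vert}(P)$ is the vertex set of a polytope $P$. For $p\in\operatorname{vert}(\operatorname{Vor}_\Gamma)$, the Delaunay cell of $p$ is $\operatorname{Del}_\Gamma(p)=\operatorname{conv}\{\xi\in\Gamma:p\in\operatorname{Vor}_\Gamma(\xi)\}$; these cells form a decomposition of $\mathbb{R}^n$ (the Delaunay decomposition of $\Gamma$). *)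

theory Defs
  imports "HOL-Analysis.Analysis" "HOL-Probability.Giry_Monad"
begin

section \<open>Matrices and lattices\<close>

definition pos_def_sym :: "real ^ 'n ^ 'n \<Rightarrow> bool" where
  "pos_def_sym A \<longleftrightarrow> transpose A = A \<and> (\<forall>x. x \<noteq> 0 \<longrightarrow> 0 < x \<bullet> (A *v x))"

text \<open>The square root of a positive definite symmetric matrix: its unique positive definite
  symmetric square root.\<close>

definition matrix_sqrt :: "real ^ 'n ^ 'n \<Rightarrow> real ^ 'n ^ 'n" where
  "matrix_sqrt A = (THE B. pos_def_sym B \<and> B ** B = A)"

definition int_lattice :: "(real ^ 'n) set" where
  "int_lattice = {z. \<forall>i. z $ i \<in> \<int>}"

section \<open>Voronoi and Delaunay cells\<close>

definition Vor :: "(real ^ 'n) set \<Rightarrow> real ^ 'n \<Rightarrow> (real ^ 'n) set" where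
  "Vor \<Gamma> \<xi> = {x. \<forall>\<eta>\<in>\<Gamma>. norm (x - \<xi>) \<le> norm (x - \<eta>)}"

definition polytope_vertices :: "(real ^ 'n) set \<Rightarrow> (real ^ 'n) set" where
  "polytope_vertices P = {v. v extreme_point_of P}"

definition vert_Vor :: "(real ^ 'n) set \<Rightarrow> (real ^ 'n) set" where
  "vert_Vor \<Gamma> = (\<Union>\<xi>\<in>\<Gamma>. polytope_vertices (Vor \<Gamma> \<xi>))"

definition Del :: "(real ^ 'n) set \<Rightarrow> real ^ 'n \<Rightarrow> (real ^ 'n) set" where
  "Del \<Gamma> p = convex hull {\<xi>\<in>\<Gamma>. p \<in> Vor \<Gamma> \<xi>}"

text \<open>The defining property of \<open>w\<close>, required for every vertex \<open>p\<close>, every point \<open>x\<close> of its Delaunay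
  cell and every admissible \<open>\<xi>\<close>. That exactly one such function exists expresses that the
  prescription is consistent and that the Delaunay cells cover the whole space.\<close>

definition is_delaunay_function :: "(real ^ 'n) set \<Rightarrow> (real ^ 'n \<Rightarrow> real) \<Rightarrow> bool" where
  "is_delaunay_function \<Gamma> w \<longleftrightarrow>
     (\<forall>p\<in>vert_Vor \<Gamma>. \<forall>x\<in>Del \<Gamma> p. \<forall>\<xi>\<in>\<Gamma>. p \<in> Vor \<Gamma> \<xi> \<longrightarrow>
        w x = (norm \<xi>)\<^sup>2 / 2 + p \<bullet> (x - \<xi>))"

section \<open>Alexandrov solutions\<close>

definition subdifferential :: "(real ^ 'n \<Rightarrow> real) \<Rightarrow> real ^ 'n \<Rightarrow> (real ^ 'n) set" where
  "subdifferential u x = {q. \<forall>y. u x + q \<bullet> (y - x) \<le> u y}"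

definition subdifferential_image :: "(real ^ 'n \<Rightarrow> real) \<Rightarrow> (real ^ 'n) set \<Rightarrow> (real ^ 'n) set" where
  "subdifferential_image u E = (\<Union>x\<in>E. subdifferential u x)"

text \<open>For a convex function the image of a Borel set under the subdifferential is always Lebesgue
  measurable. It is required explicitly here only because \<^const>\<open>emeasure\<close> is \<open>0\<close> on
  non-measurable sets.\<close>

definition alexandrov_solution :: "(real ^ 'n \<Rightarrow> real) \<Rightarrow> (real ^ 'n) measure \<Rightarrow> bool" where
  "alexandrov_solution u \<mu> \<longleftrightarrow>
     convex_on UNIV u \<and>
     (\<forall>E\<in>sets borel.
        subdifferential_image u E \<in> sets lebesgue \<and>
        emeasure lebesgue (subdifferential_image u E) = emeasure \<mu> E)"

text \<open>The sum of the Dirac masses \<^term>\<open>return borel z\<close> over \<open>z \<in> S\<close>. The integral against counting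
  measure is the sum over \<open>S\<close> in the extended nonnegative reals.\<close>

definition dirac_sum :: "(real ^ 'n) set \<Rightarrow> (real ^ 'n) measure" where
  "dirac_sum S = measure_of UNIV (sets borel)
     (\<lambda>E. \<integral>\<^sup>+ z. emeasure (return borel z) E \<partial>count_space S)"

lemma sets_dirac_sum [simp]: "sets (dirac_sum S) = sets borel"
  unfolding dirac_sum_def using sets.sigma_sets_eq[of "borel :: (real ^ 'n) measure"] by simp

lemma emeasure_dirac_sum:
  fixes S E :: "(real ^ 'n) set"
  assumes "E \<in> sets borel"
  shows "emeasure (dirac_sum S) E = (\<integral>\<^sup>+ z. emeasure (return borel z) E \<partial>count_space S)"
proof (rule emeasure_measure_of[OF dirac_sum_def])
  show "countably_additive (sets (dirac_sum S))
      (\<lambda>E. \<integral>\<^sup>+ z. emeasure (return borel z) E \<partial>count_space S)"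
    unfolding countably_additive_def
  proof (intro allI impI)
    fix F :: "nat \<Rightarrow> (real ^ 'n) set"
    assume F: "range F \<subseteq> sets (dirac_sum S)" "disjoint_family F"
    have "(\<Sum>i. emeasure (return borel z) (F i)) = emeasure (return borel z) (\<Union>i. F i)" for z
      using F by (intro suminf_emeasure) auto
    then show "(\<Sum>i. \<integral>\<^sup>+ z. emeasure (return borel z) (F i) \<partial>count_space S)
        = (\<integral>\<^sup>+ z. emeasure (return borel z) (\<Union> (range F)) \<partial>count_space S)"
      by (subst nn_integral_suminf[symmetric]) auto
  qed
qed (use assms in \<open>auto simp: positive_def\<close>)

definition has_quadratic_part :: "(real ^ 'n \<Rightarrow> real) \<Rightarrow> real ^ 'n ^ 'n \<Rightarrow> bool" where
  "has_quadratic_part u A \<longleftrightarrow>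
     (\<forall>z\<in>int_lattice. \<forall>x.
        u (x + z) - ((x + z) \<bullet> (A *v (x + z))) / 2 = u x - (x \<bullet> (A *v x)) / 2)"

end

theory Submission
  imports Defs
begin

text \<open>
  Everything rests on a pair of conjugate convex functions. For a discrete set \<open>\<Gamma>\<close> let
  \<open>h y = max {y \<bullet> \<xi> - |\<xi>|\<^sup>2 / 2 | \<xi> \<in> \<Gamma>}\<close>. Completing the square gives
  \<open>y \<bullet> \<xi> - |\<xi>|\<^sup>2 / 2 = (|y|\<^sup>2 - |y - \<xi>|\<^sup>2) / 2\<close>, so the maximum is attained exactly at the sites \<open>\<xi>\<close>
  nearest to \<open>y\<close>: the Voronoi cells are the domains of linearity of \<open>h\<close>
  (\<open>affine_le_voronoi_potential\<close>). Let \<open>w\<close> be the convex conjugate of \<open>h\<close>. A point \<open>p\<close> maximises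
  \<open>y \<mapsto> y \<bullet> x - h y\<close> iff \<open>x\<close> is a convex combination of the sites nearest to \<open>p\<close>, that is, iff
  \<open>x \<in> Del \<Gamma> p\<close> (\<open>delaunay_potential_on_Del\<close>, \<open>maximiser_in_Del\<close>). Hence the affine formulas that
  define the Delaunay function all agree with \<open>w\<close>. They also reach every point: inside one Voronoi
  cell the maximisers form a compact face, whose extreme points are Voronoi vertices (\<open>Del_cover\<close>).

  Conjugacy identifies the subdifferential of \<open>w\<close> at \<open>x\<close> with the set of those maximisers. At a site
  it is the Voronoi cell; at any other point it lies in an intersection of two different cells, and
  all these intersections together are a null set. So the Monge-Ampere measure of \<open>w\<close> is
  concentrated on \<open>\<Gamma>\<close>, and the mass at a site is the volume of its cell. For a lattice \<open>B \<int>\<^sup>n\<close> this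
  volume is \<open>|det B|\<close>, since the cell and the parallelepiped \<open>B [0,1]\<^sup>n\<close> tile space by the same
  translations (\<open>emeasure_tiles_eq\<close>, \<open>measure_Vor\<close>). Composition with the symmetric matrix
  \<open>B = A\<^sup>1\<^sup>/\<^sup>2\<close> multiplies the mass by a further \<open>|det B|\<close>, which gives \<open>det A = 1\<close>.

  For uniqueness, a solution \<open>v\<close> with the prescribed quadratic part, normalised
  by an additive constant, has the same values on the lattice as \<open>u\<close>. By convexity it lies below \<open>u\<close>
  on every Delaunay cell. On the other hand, its subdifferential at a lattice point is contained in
  that of \<open>u\<close> and has the same volume, so the supporting planes of \<open>v\<close> at lattice points have
  slopes in a set of full measure. A set of full measure is dense, hence \<open>v\<close> lies above all the
  supporting planes of \<open>u\<close> (\<open>convex_interpolant_eq_delaunay_potential\<close>).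
\<close>

section \<open>Lebesgue measure of linear images and of almost disjoint unions\<close>

text \<open>Both sides are multiplicative in \<open>f\<close>, so it suffices to treat singular maps, diagonal maps,
  transpositions of coordinates and shears. The last two have determinant \<open>\<plusminus>1\<close>, being a row
  permutation and a row operation applied to the identity matrix, and they preserve volumes of boxes.\<close>

lemma linear_image_measure:
  fixes f :: "real ^ 'n \<Rightarrow> real ^ 'n"
  assumes "linear f" "S \<in> lmeasurable"
  shows lmeasurable_linear_image: "f ` S \<in> lmeasurable"
    and measure_lebesgue_linear_image: "measure lebesgue (f ` S) = \<bar>det (matrix f)\<bar> * measure lebesgue S"
proof -
  define P where "P f \<longleftrightarrow> (\<forall>S\<in>lmeasurable. f ` S \<in> lmeasurable \<and>
      measure lebesgue (f ` S) = \<bar>det (matrix f)\<bar> * measure lebesgue S)"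
    for f :: "real ^ 'n \<Rightarrow> real ^ 'n"
  have "P f"
    using assms(1)
  proof (rule induct_linear_elementary)
    fix f g :: "real ^ 'n \<Rightarrow> real ^ 'n"
    assume "linear f" "linear g" "P f" "P g"
    then show "P (f \<circ> g)"
      unfolding P_def using matrix_compose[of g f]
      by (simp add: det_mul abs_mult image_comp[symmetric, of f g] del: image_comp o_apply)
  next
    fix f :: "real ^ 'n \<Rightarrow> real ^ 'n" and i
    assume f: "linear f" and 0: "\<And>x. f x $ i = 0"
    have "\<not> surj f"
      using 0 by (metis surjD vec_component zero_neq_one)
    then have "\<not> inj f"
      using f linear_injective_imp_surjective by blast
    then show "P f"
      unfolding P_def using negligible_linear_singular_image[OF f] det_nz_iff_inj[OF f]
      by (auto simp: negligible_iff_measure)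
  next
    fix c :: "'n \<Rightarrow> real"
    show "P (\<lambda>x. \<chi> i. c i * x $ i)"
      unfolding P_def
      by (auto simp: measurable_stretch measure_stretch axis_def matrix_def det_diagonal)
  next
    fix m n :: 'n
    let ?s = "Transposition.transpose m n"
    let ?h = "\<lambda>v::real ^ 'n. \<chi> i. v $ ?s i"
    have lin: "linear ?h"
      by (rule linearI) (simp_all add: plus_vec_def scaleR_vec_def)
    have "matrix ?h = (\<chi> i. mat 1 $ ?s i)"
      by (auto simp: matrix_def mat_def axis_def vec_eq_iff)
    then have det: "\<bar>det (matrix ?h)\<bar> = 1"
      by (simp add: det_permute_rows permutes_swap_id abs_mult sign_def)
    have "measure lebesgue (?h ` cbox a b) = measure lebesgue (cbox a b)" for a b
    proof -
      have hh: "?h (?h x) = x" for x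
        by (simp add: vec_eq_iff)
      have *: "?h x \<in> cbox (?h c) (?h d) \<longleftrightarrow> x \<in> cbox c d" for x c d
        by (simp add: mem_box_cart) (metis transpose_involutory)
      have eq: "?h ` cbox a b = cbox (?h a) (?h b)"
      proof
        show "?h ` cbox a b \<subseteq> cbox (?h a) (?h b)"
          using *[of _ a b] by blast
        show "cbox (?h a) (?h b) \<subseteq> ?h ` cbox a b"
        proof
          fix y assume "y \<in> cbox (?h a) (?h b)"
          then have "?h y \<in> cbox a b"
            using *[of "?h y" a b] by (simp only: hh)
          then show "y \<in> ?h ` cbox a b"
            by (metis (no_types) hh image_eqI)
        qed
      qed
      have "(\<Prod>i\<in>UNIV. b $ ?s i - a $ ?s i) = (\<Prod>i\<in>UNIV. b $ i - a $ i)"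
        using prod.permute[OF permutes_swap_id, of m UNIV n "\<lambda>i. b $ i - a $ i"] by (simp add: comp_def)
      moreover have "cbox (?h a) (?h b) = {} \<longleftrightarrow> cbox a b = {}"
        using eq by blast
      ultimately show ?thesis
        unfolding eq by (simp add: content_cbox_if_cart)
    qed
    then have "measure lebesgue (?h ` cbox a b) = 1 * measure lebesgue (cbox a b)" for a b
      by simp
    from measure_linear_sufficient[OF lin _ this] show "P ?h"
      unfolding P_def det by (intro ballI) (auto simp only:)
  next
    fix m n :: 'n
    assume mn: "m \<noteq> n"
    let ?h = "\<lambda>v::real ^ 'n. \<chi> i. if i = m then v $ m + v $ n else v $ i"
    have lin: "linear ?h"
      by (rule linearI) (auto simp: algebra_simps plus_vec_def scaleR_vec_def vec_eq_iff)
    have "matrix ?h = (\<chi> i. if i = m then row m (mat 1) + 1 *s row n (mat 1) else row i (mat 1))"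
      by (auto simp: matrix_def mat_def axis_def row_def vec_eq_iff)
    then have det: "det (matrix ?h) = 1"
      using det_row_operation[OF mn, of "mat 1 :: real ^ 'n ^ 'n" 1] by simp
    have "measure lebesgue (?h ` cbox a b) = measure lebesgue (cbox a b)" for a b
    proof (cases "cbox a b = {}")
      case False
      \<comment> \<open>the volume of a sheared box is known if its corner has nonnegative coordinates; translation gives the rest\<close>
      have ab: "cbox a b = (+) a ` cbox 0 (b - a)"
        by (simp add: cbox_translation[symmetric])
      then have "?h ` cbox a b = (+) (?h a) ` ?h ` cbox 0 (b - a)"
        using linear_add[OF lin] by (auto simp: image_image)
      moreover have "cbox 0 (b - a) \<noteq> {}"
        using False ab by blast
      ultimately show ?thesis
        using measure_shear_interval[OF mn, of 0 "b - a"] ab by (simp add: measure_translation)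
    qed simp
    then have "measure lebesgue (?h ` cbox a b) = 1 * measure lebesgue (cbox a b)" for a b
      by simp
    from measure_linear_sufficient[OF lin _ this] show "P ?h"
      unfolding P_def det abs_one by (intro ballI) (auto simp only:)
  qed
  then show "f ` S \<in> lmeasurable" "measure lebesgue (f ` S) = \<bar>det (matrix f)\<bar> * measure lebesgue S"
    using assms(2) unfolding P_def by auto
qed

lemma negligible_linear_image:
  fixes f :: "'a::euclidean_space \<Rightarrow> 'a"
  assumes "linear f" "negligible S"
  shows "negligible (f ` S)"
  by (rule negligible_differentiable_image_negligible[OF order_refl assms(2)
        linear_imp_differentiable_on[OF assms(1)]])

text \<open>Voronoi cells and unit cubes are closed and share faces, so the unions measured below are disjoint
  only up to null sets.\<close>

lemma emeasure_UN_almost_disjoint: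
  fixes X :: "'i \<Rightarrow> 'a::euclidean_space set"
  assumes I: "countable I"
    and meas: "\<And>i. i \<in> I \<Longrightarrow> X i \<in> sets lebesgue"
    and overlap: "\<And>i j. i \<in> I \<Longrightarrow> j \<in> I \<Longrightarrow> i \<noteq> j \<Longrightarrow> negligible (X i \<inter> X j)"
  shows "emeasure lebesgue (\<Union>i\<in>I. X i) = (\<integral>\<^sup>+i. emeasure lebesgue (X i) \<partial>count_space I)"
proof -
  \<comment> \<open>removing all overlaps at once makes the family disjoint and costs only a null set\<close>
  define N where "N = (\<Union>(i, j)\<in>I \<times> I - Id. X i \<inter> X j)"
  have "negligible N"
    unfolding N_def using I overlap
    by (intro negligible_countable_Union countable_image countable_Diff countable_SIGMA) auto
  then have N: "N \<in> null_sets lebesgue"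
    by (simp add: negligible_iff_null_sets)
  then have NS: "N \<in> sets lebesgue"
    by auto
  have "(\<Union>i\<in>I. X i) \<in> sets lebesgue"
    using I meas by (intro sets.countable_UN') auto
  then have "emeasure lebesgue (\<Union>i\<in>I. X i) = emeasure lebesgue ((\<Union>i\<in>I. X i) - N)"
    using N by (intro emeasure_Diff_null_set[symmetric])
  also have "(\<Union>i\<in>I. X i) - N = (\<Union>i\<in>I. X i - N)"
    by blast
  also have "emeasure lebesgue \<dots> = (\<integral>\<^sup>+i. emeasure lebesgue (X i - N) \<partial>count_space I)"
  proof (rule emeasure_UN_countable[OF _ I])
    show "disjoint_family_on (\<lambda>i. X i - N) I"
      by (auto simp: disjoint_family_on_def N_def)
  qed (use meas NS in auto)
  also have "\<dots> = (\<integral>\<^sup>+i. emeasure lebesgue (X i) \<partial>count_space I)"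
    using N meas by (intro nn_integral_cong emeasure_Diff_null_set) auto
  finally show ?thesis .
qed

text \<open>Cut \<open>S\<close> along the translates of \<open>T\<close> and move each piece back by the corresponding translation:
  the result is \<open>T\<close> cut along the translates of \<open>S\<close>.\<close>

lemma emeasure_tiles_eq:
  fixes \<Gamma> S T :: "'a::euclidean_space set"
  assumes \<Gamma>: "countable \<Gamma>" "\<And>\<gamma>. \<gamma> \<in> \<Gamma> \<Longrightarrow> - \<gamma> \<in> \<Gamma>"
    and S: "S \<in> sets lebesgue" "(\<Union>\<gamma>\<in>\<Gamma>. (+) \<gamma> ` S) = UNIV"
      "\<And>\<gamma> \<delta>. \<gamma> \<in> \<Gamma> \<Longrightarrow> \<delta> \<in> \<Gamma> \<Longrightarrow> \<gamma> \<noteq> \<delta> \<Longrightarrow> negligible ((+) \<gamma> ` S \<inter> (+) \<delta> ` S)"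
    and T: "T \<in> sets lebesgue" "(\<Union>\<gamma>\<in>\<Gamma>. (+) \<gamma> ` T) = UNIV"
      "\<And>\<gamma> \<delta>. \<gamma> \<in> \<Gamma> \<Longrightarrow> \<delta> \<in> \<Gamma> \<Longrightarrow> \<gamma> \<noteq> \<delta> \<Longrightarrow> negligible ((+) \<gamma> ` T \<inter> (+) \<delta> ` T)"
  shows "emeasure lebesgue S = emeasure lebesgue T"
proof -
  have cut: "emeasure lebesgue P = (\<integral>\<^sup>+\<gamma>. emeasure lebesgue (P \<inter> (+) \<gamma> ` Q) \<partial>count_space \<Gamma>)"
    if P: "P \<in> sets lebesgue" and Q: "Q \<in> sets lebesgue" "(\<Union>\<gamma>\<in>\<Gamma>. (+) \<gamma> ` Q) = UNIV"
      "\<And>\<gamma> \<delta>. \<gamma> \<in> \<Gamma> \<Longrightarrow> \<delta> \<in> \<Gamma> \<Longrightarrow> \<gamma> \<noteq> \<delta> \<Longrightarrow> negligible ((+) \<gamma> ` Q \<inter> (+) \<delta> ` Q)"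
    for P Q :: "'a set"
  proof -
    have "P = (\<Union>\<gamma>\<in>\<Gamma>. P \<inter> (+) \<gamma> ` Q)"
      unfolding Int_UN_distrib[symmetric] Q(2) by simp
    then have "emeasure lebesgue P = emeasure lebesgue (\<Union>\<gamma>\<in>\<Gamma>. P \<inter> (+) \<gamma> ` Q)"
      by (rule arg_cong)
    also have "\<dots> = (\<integral>\<^sup>+\<gamma>. emeasure lebesgue (P \<inter> (+) \<gamma> ` Q) \<partial>count_space \<Gamma>)"
    proof (rule emeasure_UN_almost_disjoint[OF \<Gamma>(1)])
      fix \<gamma> \<delta> assume "\<gamma> \<in> \<Gamma>" "\<delta> \<in> \<Gamma>" "\<gamma> \<noteq> \<delta>"
      from Q(3)[OF this] show "negligible ((P \<inter> (+) \<gamma> ` Q) \<inter> (P \<inter> (+) \<delta> ` Q))"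
        by (rule negligible_subset) blast
    qed (use P Q(1) lebesgue_sets_translation in auto)
    finally show ?thesis .
  qed
  have move: "emeasure lebesgue (S \<inter> (+) \<gamma> ` T) = emeasure lebesgue (T \<inter> (+) (- \<gamma>) ` S)" for \<gamma>
  proof -
    have "(+) (- \<gamma>) ` (S \<inter> (+) \<gamma> ` T) = T \<inter> (+) (- \<gamma>) ` S"
      by (simp add: image_Int image_image Int_commute)
    then show ?thesis
      using emeasure_lebesgue_affine[of 1 "- \<gamma>" "S \<inter> (+) \<gamma> ` T"] by (simp add: add.commute)
  qed
  have "emeasure lebesgue S = (\<integral>\<^sup>+\<gamma>. emeasure lebesgue (T \<inter> (+) (- \<gamma>) ` S) \<partial>count_space \<Gamma>)"
    using cut[OF S(1) T] by (simp add: move)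
  also have "\<dots> = (\<integral>\<^sup>+\<gamma>. emeasure lebesgue (T \<inter> (+) \<gamma> ` S) \<partial>count_space \<Gamma>)"
  proof (rule nn_integral_bij_count_space)
    show "bij_betw uminus \<Gamma> \<Gamma>"
      using \<Gamma>(2) by (intro bij_betw_byWitness[of _ uminus]) auto
  qed
  also have "\<dots> = emeasure lebesgue T"
    using cut[OF T(1) S] by simp
  finally show ?thesis .
qed

section \<open>The square root of a positive definite matrix\<close>

lemma pos_def_sym_coercive:
  fixes A :: "real ^ 'n ^ 'n"
  assumes "pos_def_sym A"
  obtains m where "m > 0" "\<And>x. m * (norm x)\<^sup>2 \<le> x \<bullet> (A *v x)"
proof -
  have cont: "continuous_on (sphere 0 1) (\<lambda>x. x \<bullet> (A *v x))"
    by (intro continuous_intros)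
  then obtain s :: "real ^ 'n" where s: "s \<in> sphere 0 1"
      "\<And>x. x \<in> sphere 0 1 \<Longrightarrow> s \<bullet> (A *v s) \<le> x \<bullet> (A *v x)"
    using continuous_attains_inf[OF compact_sphere _ cont] sphere_eq_empty[of "0 :: real ^ 'n" 1] by force
  have "(s \<bullet> (A *v s)) * (norm x)\<^sup>2 \<le> x \<bullet> (A *v x)" for x
  proof (cases "x = 0")
    case False
    have "s \<bullet> (A *v s) \<le> (x /\<^sub>R norm x) \<bullet> (A *v (x /\<^sub>R norm x))"
      using False by (intro s) simp
    also have "\<dots> = (x \<bullet> (A *v x)) / (norm x)\<^sup>2"
      by (simp add: matrix_vector_mult_scaleR power2_eq_square divide_inverse)
    finally show ?thesis
      using False by (simp add: field_simps)
  qed simp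
  moreover have "s \<bullet> (A *v s) > 0"
    using assms s(1) unfolding pos_def_sym_def by (metis mem_sphere_0 norm_zero zero_neq_one)
  ultimately show thesis
    using that by blast
qed

text \<open>For small \<open>t > 0\<close> the operator \<open>X = 1 - t A\<close> has norm \<open>r < 1\<close>. A square root \<open>C = 1 - Y\<close> of
  \<open>t A = 1 - X\<close> amounts to a fixed point of \<open>F Y = (X + Y\<^sup>2) / 2\<close>. On the symmetric operators of norm at
  most \<open>\<rho>\<close>, where \<open>\<rho> < 1\<close> is the fixed point of the scalar map \<open>s \<mapsto> (r + s\<^sup>2) / 2\<close>, \<open>F\<close> is a
  self-map and a contraction with constant \<open>\<rho>\<close>, so Banach's theorem applies. Finally \<open>\<parallel>Y\<parallel> < 1\<close> makes
  \<open>1 - Y\<close> positive definite.\<close>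

lemma pos_def_sym_sqrt_exists:
  fixes A :: "real ^ 'n ^ 'n"
  assumes A: "pos_def_sym A"
  shows "\<exists>B. pos_def_sym B \<and> B ** B = A"
proof -
  have sym: "(A *v x) \<bullet> y = x \<bullet> (A *v y)" for x y
    using A unfolding pos_def_sym_def by (metis dot_lmul_matrix transpose_matrix_vector)
  obtain m where m: "m > 0" "\<And>x. m * (norm x)\<^sup>2 \<le> x \<bullet> (A *v x)"
    using pos_def_sym_coercive[OF A] by blast
  obtain M where M: "M > 0" "\<And>x. norm (A *v x) \<le> M * norm x"
    using linear_bounded_pos[OF matrix_vector_mul_linear, of A] by (auto simp: mult.commute)
  \<comment> \<open>the minimiser of \<open>1 - 2 t m + t\<^sup>2 M\<^sup>2\<close>, which bounds the squared norm of \<open>1 - t A\<close>\<close>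
  define t where "t = m / M\<^sup>2"
  have t: "t > 0"
    using m M by (simp add: t_def)
  define X where "X = Blinfun (\<lambda>x. x - t *\<^sub>R (A *v x))"
  have Xapp: "blinfun_apply X x = x - t *\<^sub>R (A *v x)" for x
    unfolding X_def
    by (subst bounded_linear_Blinfun_apply) (auto intro!: bounded_linear_intros matrix_vector_mul_bounded_linear)
  define \<kappa> where "\<kappa> = 1 - m\<^sup>2 / M\<^sup>2"
  have Xle: "(norm (X x))\<^sup>2 \<le> \<kappa> * (norm x)\<^sup>2" for x
  proof -
    have "(norm (X x))\<^sup>2 = (norm x)\<^sup>2 - 2 * t * (x \<bullet> (A *v x)) + t\<^sup>2 * (norm (A *v x))\<^sup>2"
      unfolding Xapp power2_norm_eq_inner by (simp add: inner_diff inner_commute power2_eq_square)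
    also have "\<dots> \<le> (norm x)\<^sup>2 - 2 * t * (m * (norm x)\<^sup>2) + t\<^sup>2 * (M * norm x)\<^sup>2"
      using t m(2)[of x] power_mono[OF M(2)[of x], of 2] by (intro add_mono diff_mono mult_left_mono) auto
    also have "\<dots> = \<kappa> * (norm x)\<^sup>2"
      using M(1) by (simp add: t_def \<kappa>_def field_simps power2_eq_square)
    finally show ?thesis .
  qed
  have \<kappa>: "0 \<le> \<kappa>" "\<kappa> < 1"
  proof -
    have "norm (1 :: real ^ 'n) > 0"
      by simp
    then show "0 \<le> \<kappa>"
      using Xle[of 1] by (smt (verit) mult_neg_pos zero_less_power zero_le_power2)
    show "\<kappa> < 1"
      using m M by (simp add: \<kappa>_def)
  qed
  define r where "r = sqrt \<kappa>"
  have r: "0 \<le> r" "r < 1"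
    using \<kappa> by (auto simp: r_def)
  have normX: "norm X \<le> r"
  proof (rule norm_blinfun_bound)
    show "norm (X x) \<le> r * norm x" for x
      using Xle[of x] unfolding r_def
      by (metis real_sqrt_le_mono real_sqrt_abs abs_norm_cancel real_sqrt_mult)
  qed (use r in auto)
  define \<rho> where "\<rho> = 1 - sqrt (1 - r)"
  have \<rho>: "0 \<le> \<rho>" "\<rho> < 1" "r + \<rho>\<^sup>2 = 2 * \<rho>"
    using r by (auto simp: \<rho>_def power2_eq_square algebra_simps)
  define S where "S = cball 0 \<rho> \<inter> {Y :: (real^'n) \<Rightarrow>\<^sub>L (real^'n). \<forall>x y. Y x \<bullet> y = x \<bullet> Y y}"
  define F where "F Y = (1/2) *\<^sub>R (X + (Y o\<^sub>L Y))" for Y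
  have "closed S"
    unfolding S_def
    by (intro closed_Int closed_cball closed_Collect_all closed_Collect_eq continuous_intros)
  then have "complete S"
    by (simp add: complete_eq_closed)
  moreover have "0 \<in> S"
    using \<rho>(1) by (simp add: S_def)
  moreover have "F ` S \<subseteq> S"
  proof clarsimp
    fix Y assume Y: "Y \<in> S"
    have "norm (F Y) \<le> (norm X + norm (Y o\<^sub>L Y)) / 2"
      unfolding F_def by (simp add: norm_triangle_ineq)
    also have "\<dots> \<le> (r + \<rho> * \<rho>) / 2"
      using normX norm_blinfun_compose[of Y Y] Y mult_mono[of "norm Y" \<rho> "norm Y" \<rho>] \<rho>(1)
      by (auto simp: S_def)
    also have "\<dots> = \<rho>"
      using \<rho>(3) by (simp add: power2_eq_square)
    finally have "norm (F Y) \<le> \<rho>" .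
    moreover have "F Y x \<bullet> y = x \<bullet> F Y y" for x y
      using Y by (simp add: S_def F_def Xapp blinfun.bilinear_simps inner_simps sym)
    ultimately show "F Y \<in> S"
      by (simp add: S_def)
  qed
  moreover have "dist (F Y) (F Z) \<le> \<rho> * dist Y Z" if "Y \<in> S" "Z \<in> S" for Y Z
  proof -
    have "F Y - F Z = (1/2) *\<^sub>R ((Y o\<^sub>L (Y - Z)) + ((Y - Z) o\<^sub>L Z))"
      unfolding F_def by (rule blinfun_eqI) (simp add: blinfun.bilinear_simps scaleR_diff_right[symmetric])
    then have "norm (F Y - F Z) \<le> (norm (Y o\<^sub>L (Y - Z)) + norm ((Y - Z) o\<^sub>L Z)) / 2"
      by (simp add: norm_triangle_ineq)
    also have "norm (Y o\<^sub>L (Y - Z)) \<le> \<rho> * norm (Y - Z)"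
      using that mult_right_mono[of "norm Y" \<rho> "norm (Y - Z)"]
      by (intro order_trans[OF norm_blinfun_compose]) (simp add: S_def)
    also have "norm ((Y - Z) o\<^sub>L Z) \<le> norm (Y - Z) * \<rho>"
      using that mult_left_mono[of "norm Z" \<rho> "norm (Y - Z)"]
      by (intro order_trans[OF norm_blinfun_compose]) (simp add: S_def)
    finally show ?thesis
      by (simp add: dist_norm mult.commute)
  qed
  ultimately obtain Y where Y: "Y \<in> S" "F Y = Y"
    using Banach_fix[of S \<rho> F] \<rho>(1,2) by (metis empty_iff)
  have YY: "2 *\<^sub>R Y x = X x + Y (Y x)" for x
    using arg_cong[OF Y(2), of "\<lambda>Z. 2 *\<^sub>R blinfun_apply Z x"] by (simp add: F_def blinfun.bilinear_simps)
  have Ysym: "Y x \<bullet> y = x \<bullet> Y y" and Yle: "norm Y \<le> \<rho>" for x y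
    using Y(1) by (auto simp: S_def)
  define C where "C x = x - Y x" for x
  have CC: "C (C x) = t *\<^sub>R (A *v x)" for x
    using YY[of x] by (simp add: C_def blinfun.bilinear_simps Xapp algebra_simps scaleR_2)
  define B where "B = matrix (\<lambda>x. (1 / sqrt t) *\<^sub>R C x)"
  have "linear (\<lambda>x. (1 / sqrt t) *\<^sub>R C x)"
    by (rule linearI) (simp_all add: C_def blinfun.bilinear_simps algebra_simps)
  then have B: "B *v x = (1 / sqrt t) *\<^sub>R C x" for x
    unfolding B_def by (simp add: matrix_works)
  have "B ** B = A"
  proof -
    have "C (c *\<^sub>R x) = c *\<^sub>R C x" for c x
      by (simp add: C_def blinfun.bilinear_simps algebra_simps)
    then show ?thesis
      using t CC by (simp add: matrix_eq matrix_vector_mul_assoc[symmetric] B)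
  qed
  moreover have "transpose B = B"
  proof -
    have "(transpose B *v x) \<bullet> y = (B *v x) \<bullet> y" for x y
      unfolding transpose_matrix_vector dot_lmul_matrix by (simp add: B C_def Ysym inner_simps)
    then show ?thesis
      by (metis matrix_eq vector_eq_rdot)
  qed
  moreover have "0 < x \<bullet> (B *v x)" if "x \<noteq> 0" for x
  proof -
    have "x \<bullet> Y x \<le> norm x * (norm Y * norm x)"
      using norm_cauchy_schwarz[of x "Y x"] norm_blinfun[of Y x] mult_left_mono[of _ _ "norm x"]
      by (meson norm_ge_zero order_trans)
    also have "\<dots> \<le> \<rho> * (norm x * norm x)"
      using mult_right_mono[OF Yle, of "norm x * norm x"] by (simp add: mult.left_commute)
    also have "\<dots> < 1 * (norm x * norm x)"
      using \<rho>(2) that by (intro mult_strict_right_mono) auto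
    finally have "x \<bullet> C x > 0"
      by (simp add: C_def inner_diff power2_norm_eq_inner[symmetric] power2_eq_square)
    then show ?thesis
      using t by (simp add: B)
  qed
  ultimately show ?thesis
    unfolding pos_def_sym_def by blast
qed

text \<open>With \<open>D = B - C\<close> the equation \<open>B\<^sup>2 = C\<^sup>2\<close> becomes \<open>B D + D C = 0\<close>. Multiplying by \<open>D\<close> and taking traces
  gives \<open>tr (D B D) + tr (D C D) = 0\<close>, a sum of two nonnegative numbers; so every column of \<open>D\<close> is
  annihilated by the positive form \<open>B\<close>.\<close>

lemma pos_def_sym_sqrt_unique:
  fixes B C :: "real ^ 'n ^ 'n"
  assumes B: "pos_def_sym B" and C: "pos_def_sym C" and eq: "B ** B = C ** C"
  shows "B = C"
proof -
  define D where "D = B - C"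
  have D: "transpose D = D"
    using B C by (simp add: D_def pos_def_sym_def transpose_def vec_eq_iff)
  have trace: "trace (D ** (E ** D)) = (\<Sum>i\<in>UNIV. (D *v axis i 1) \<bullet> (E *v (D *v axis i 1)))"
    for E :: "real ^ 'n ^ 'n"
  proof -
    have "(D *v axis i 1) \<bullet> (E *v (D *v axis i 1)) = (D ** (E ** D)) $ i $ i" for i
    proof -
      have "(D *v axis i 1) \<bullet> (E *v (D *v axis i 1)) = axis i 1 \<bullet> ((D ** (E ** D)) *v axis i 1)"
        by (metis D dot_lmul_matrix matrix_vector_mul_assoc transpose_matrix_vector)
      then show ?thesis
        by (simp add: inner_axis' matrix_vector_mult_basis column_def)
    qed
    then show ?thesis
      by (simp add: trace_def)
  qed
  have nonneg: "0 \<le> x \<bullet> (E *v x)" if "pos_def_sym E" for E :: "real ^ 'n ^ 'n" and x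
    using that unfolding pos_def_sym_def by (cases "x = 0") (auto intro: less_imp_le)
  have "B *v (B *v x) = C *v (C *v x)" for x
    by (simp add: matrix_vector_mul_assoc eq)
  then have "B ** D + D ** C = 0"
    by (simp add: matrix_eq matrix_vector_mult_add_rdistrib matrix_vector_mul_assoc[symmetric] D_def
        matrix_vector_mult_diff_rdistrib matrix_vector_mult_diff_distrib)
  then have "trace (D ** (B ** D + D ** C)) = 0"
    by (simp add: trace_def)
  moreover have "trace (D ** (D ** C)) = trace (D ** (C ** D))"
    by (metis trace_mul_sym matrix_mul_assoc)
  ultimately have "trace (D ** (B ** D)) + trace (D ** (C ** D)) = 0"
    by (simp add: matrix_add_ldistrib trace_add)
  moreover have "0 \<le> trace (D ** (C ** D))" "0 \<le> trace (D ** (B ** D))"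
    unfolding trace by (simp_all add: sum_nonneg nonneg B C)
  ultimately have "trace (D ** (B ** D)) = 0"
    by simp
  then have "(D *v axis i 1) \<bullet> (B *v (D *v axis i 1)) = 0" for i
    unfolding trace by (subst (asm) sum_nonneg_eq_0_iff) (auto simp: nonneg B)
  then have "D *v axis i 1 = 0" for i
    using B unfolding pos_def_sym_def by (metis less_irrefl)
  then have "D = 0"
    by (simp add: matrix_vector_mult_basis column_def vec_eq_iff)
  then show ?thesis
    by (simp add: D_def)
qed

lemma matrix_sqrt:
  fixes A :: "real ^ 'n ^ 'n"
  assumes "pos_def_sym A"
  shows "pos_def_sym (matrix_sqrt A)" "matrix_sqrt A ** matrix_sqrt A = A"
proof -
  have "\<exists>!B. pos_def_sym B \<and> B ** B = A"
    using pos_def_sym_sqrt_exists[OF assms] pos_def_sym_sqrt_unique by blast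
  from theI'[OF this] show "pos_def_sym (matrix_sqrt A)" "matrix_sqrt A ** matrix_sqrt A = A"
    unfolding matrix_sqrt_def by auto
qed

section \<open>Subdifferentials and Alexandrov solutions with atoms\<close>

lemma convex_on_if_subdifferential_nonempty:
  fixes f :: "real ^ 'n \<Rightarrow> real"
  assumes "\<And>x. subdifferential f x \<noteq> {}"
  shows "convex_on UNIV f"
proof (intro convex_onI)
  fix t :: real and x y :: "real ^ 'n"
  assume t: "0 < t" "t < 1"
  let ?z = "(1 - t) *\<^sub>R x + t *\<^sub>R y"
  obtain q where q: "\<And>y. f ?z + q \<bullet> (y - ?z) \<le> f y"
    using assms[of ?z] by (auto simp: subdifferential_def)
  have "f ?z = (1 - t) * (f ?z + q \<bullet> (x - ?z)) + t * (f ?z + q \<bullet> (y - ?z))"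
    by (simp add: inner_simps algebra_simps)
  also have "\<dots> \<le> (1 - t) * f x + t * f y"
    using t q by (intro add_mono mult_left_mono) auto
  finally show "f ?z \<le> (1 - t) * f x + t * f y" .
qed simp

lemma subdifferential_compose_matrix:
  fixes B :: "real ^ 'n ^ 'n"
  assumes "det B \<noteq> 0"
  shows "subdifferential (\<lambda>x. f (B *v x)) x = (*v) (transpose B) ` subdifferential f (B *v x)"
proof
  have inv: "invertible B"
    using assms invertible_det_nz by blast
  have adj: "(transpose B *v q) \<bullet> y = q \<bullet> (B *v y)" for q y
    by (simp add: dot_lmul_matrix)
  show "(*v) (transpose B) ` subdifferential f (B *v x) \<subseteq> subdifferential (\<lambda>x. f (B *v x)) x"
    unfolding subdifferential_def
    by (auto simp only: adj matrix_vector_mult_diff_distrib mem_Collect_eq)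
  show "subdifferential (\<lambda>x. f (B *v x)) x \<subseteq> (*v) (transpose B) ` subdifferential f (B *v x)"
  proof
    fix q assume q: "q \<in> subdifferential (\<lambda>x. f (B *v x)) x"
    have "surj ((*v) (transpose B))"
      using inv transpose_invertible invertible_eq_bij bij_is_surj by blast
    then obtain p where p: "q = transpose B *v p"
      by blast
    have "p \<in> subdifferential f (B *v x)"
      unfolding subdifferential_def
    proof (clarify)
      fix y
      have "surj ((*v) B)"
        using inv invertible_eq_bij bij_is_surj by blast
      then obtain y' where y': "y = B *v y'"
        by blast
      have "f (B *v x) + q \<bullet> (y' - x) \<le> f (B *v y')"
        using q by (simp add: subdifferential_def)
      then show "f (B *v x) + p \<bullet> (y - B *v x) \<le> f y"
        unfolding p adj y' by (simp add: matrix_vector_mult_diff_distrib)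
    qed
    then show "q \<in> (*v) (transpose B) ` subdifferential f (B *v x)"
      using p by blast
  qed
qed

text \<open>The Monge-Ampere measure of \<open>u\<close> on \<open>E\<close> is the volume of the cells of the atoms in \<open>E\<close>, because the
  subgradients at all other points are a null set and different cells overlap in null sets.\<close>

lemma alexandrov_solution_dirac_sumI:
  assumes conv: "convex_on UNIV u"
    and S: "countable S"
    and atom: "\<And>z. z \<in> S \<Longrightarrow> subdifferential u z \<in> sets lebesgue"
      "\<And>z. z \<in> S \<Longrightarrow> emeasure lebesgue (subdifferential u z) = 1"
    and overlap: "\<And>y z. y \<in> S \<Longrightarrow> z \<in> S \<Longrightarrow> y \<noteq> z \<Longrightarrow>
      negligible (subdifferential u y \<inter> subdifferential u z)"
    and rest: "negligible (subdifferential_image u (- S))"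
  shows "alexandrov_solution u (dirac_sum S)"
  unfolding alexandrov_solution_def
proof (intro conjI ballI)
  fix E :: "(real ^ 'a) set"
  assume E: "E \<in> sets borel"
  let ?U = "\<Union>z\<in>S \<inter> E. subdifferential u z" and ?N = "subdifferential_image u (E - S)"
  have split: "subdifferential_image u E = ?U \<union> ?N"
    unfolding subdifferential_image_def by blast
  have "?N \<subseteq> subdifferential_image u (- S)"
    unfolding subdifferential_image_def by blast
  then have N: "?N \<in> null_sets lebesgue"
    using rest negligible_subset negligible_iff_null_sets by blast
  have SE: "countable (S \<inter> E)"
    using S by blast
  then have U: "?U \<in> sets lebesgue"
    using atom(1) by (intro sets.countable_UN') auto
  show "subdifferential_image u E \<in> sets lebesgue"
    unfolding split using U N by auto
  have "emeasure lebesgue (subdifferential_image u E) = emeasure lebesgue ?U"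
    unfolding split using U N by (rule emeasure_Un_null_set)
  also have "\<dots> = (\<integral>\<^sup>+z. emeasure lebesgue (subdifferential u z) \<partial>count_space (S \<inter> E))"
    using SE atom(1) overlap by (intro emeasure_UN_almost_disjoint) auto
  also have "\<dots> = (\<integral>\<^sup>+z. indicator E z \<partial>count_space (S \<inter> E))"
    using atom(2) by (intro nn_integral_cong) auto
  also have "\<dots> = (\<integral>\<^sup>+z. indicator E z \<partial>count_space S)"
    by (intro nn_integral_count_space_eq) auto
  also have "\<dots> = emeasure (dirac_sum S) E"
    using E by (simp add: emeasure_dirac_sum)
  finally show "emeasure lebesgue (subdifferential_image u E) = emeasure (dirac_sum S) E" .
qed (fact conv)

section \<open>Voronoi and Delaunay cells of a Delone set\<close>

text \<open>A Delone set. Local finiteness yields a nearest site for every point and only finitely many of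
  them, relative density bounds the distance to it.\<close>

locale delone_set =
  fixes \<Gamma> :: "(real ^ 'n) set"
  assumes locally_finite: "finite (\<Gamma> \<inter> cball x r)"
    and relatively_dense: "\<exists>R. \<forall>x. \<exists>\<xi>\<in>\<Gamma>. dist x \<xi> \<le> R"
begin

lemma sites_nonempty: "\<Gamma> \<noteq> {}"
  using relatively_dense by blast

lemma countable_sites: "countable \<Gamma>"
proof -
  have "\<Gamma> = (\<Union>k::nat. \<Gamma> \<inter> cball 0 (real k))"
    using real_arch_simple by auto
  then show ?thesis
    by (metis countable_UN countable_finite countableI_type locally_finite)
qed

lemma closed_sites: "closed \<Gamma>"
  unfolding closed_def open_contains_ball
proof
  fix x assume x: "x \<in> - \<Gamma>"
  obtain \<delta> where "\<delta> > 0" "\<And>\<xi>. \<xi> \<in> \<Gamma> \<inter> cball x 1 \<Longrightarrow> \<xi> \<noteq> x \<Longrightarrow> \<delta> \<le> dist x \<xi>"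
    using finite_set_avoid[OF locally_finite[of x 1], of x] by blast
  then show "\<exists>e>0. ball x e \<subseteq> - \<Gamma>"
    using x by (intro exI[of _ "min \<delta> 1"]) force
qed

lemma nearest_site_exists:
  obtains \<xi> where "\<xi> \<in> \<Gamma>" "infdist y \<Gamma> = dist y \<xi>"
  using infdist_attains_inf[OF closed_sites sites_nonempty] by blast

lemma Vor_iff_infdist:
  assumes "\<xi> \<in> \<Gamma>"
  shows "y \<in> Vor \<Gamma> \<xi> \<longleftrightarrow> dist y \<xi> = infdist y \<Gamma>"
proof -
  obtain \<eta> where \<eta>: "\<eta> \<in> \<Gamma>" "infdist y \<Gamma> = dist y \<eta>"
    using nearest_site_exists by blast
  have "y \<in> Vor \<Gamma> \<xi> \<longleftrightarrow> (\<forall>\<zeta>\<in>\<Gamma>. dist y \<xi> \<le> dist y \<zeta>)"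
    by (simp add: Vor_def dist_norm)
  also have "\<dots> \<longleftrightarrow> dist y \<xi> = infdist y \<Gamma>"
    using \<eta> infdist_le[OF assms, of y] infdist_le by (metis antisym)
  finally show ?thesis .
qed

lemma Vor_cover: "\<exists>\<xi>\<in>\<Gamma>. y \<in> Vor \<Gamma> \<xi>"
  using nearest_site_exists Vor_iff_infdist by metis

text \<open>The conjugate of the function \<open>\<xi> \<mapsto> |\<xi>|\<^sup>2 / 2\<close> on \<open>\<Gamma>\<close>, that is, the maximum over all sites of the affine
  functions in the next lemma. Written with the distance to \<open>\<Gamma>\<close> it is visibly continuous.\<close>

definition voronoi_potential :: "real ^ 'n \<Rightarrow> real" where
  "voronoi_potential y = ((norm y)\<^sup>2 - (infdist y \<Gamma>)\<^sup>2) / 2"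

text \<open>By completing the square, the affine function of the site \<open>\<xi>\<close> equals \<open>(|y|\<^sup>2 - |y - \<xi>|\<^sup>2) / 2\<close>, and so it
  is largest for the nearest sites.\<close>

lemma affine_le_voronoi_potential:
  assumes "\<xi> \<in> \<Gamma>"
  shows "y \<bullet> \<xi> - (norm \<xi>)\<^sup>2 / 2 \<le> voronoi_potential y"
    and "y \<bullet> \<xi> - (norm \<xi>)\<^sup>2 / 2 = voronoi_potential y \<longleftrightarrow> y \<in> Vor \<Gamma> \<xi>"
proof -
  have d: "y \<bullet> \<xi> - (norm \<xi>)\<^sup>2 / 2 = ((norm y)\<^sup>2 - (dist y \<xi>)\<^sup>2) / 2"
    by (simp add: dist_norm power2_norm_eq_inner inner_diff inner_commute field_simps)
  have "(infdist y \<Gamma>)\<^sup>2 \<le> (dist y \<xi>)\<^sup>2"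
    by (intro power_mono infdist_le[OF assms] infdist_nonneg)
  then show "y \<bullet> \<xi> - (norm \<xi>)\<^sup>2 / 2 \<le> voronoi_potential y"
    by (simp add: d voronoi_potential_def)
  have "(infdist y \<Gamma>)\<^sup>2 = (dist y \<xi>)\<^sup>2 \<longleftrightarrow> dist y \<xi> = infdist y \<Gamma>"
    using infdist_nonneg[of y \<Gamma>] by (auto simp: power2_eq_iff_nonneg)
  then show "y \<bullet> \<xi> - (norm \<xi>)\<^sup>2 / 2 = voronoi_potential y \<longleftrightarrow> y \<in> Vor \<Gamma> \<xi>"
    using assms by (auto simp: d voronoi_potential_def Vor_iff_infdist)
qed

lemma continuous_on_voronoi_potential: "continuous_on S voronoi_potential"
  unfolding voronoi_potential_def by (intro continuous_intros) auto

text \<open>Its graph is the lower boundary of the convex hull of the sites lifted to the paraboloid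
  \<open>x \<mapsto> |x|\<^sup>2 / 2\<close>; the Delaunay cells are the projections of the facets.\<close>

definition delaunay_potential :: "real ^ 'n \<Rightarrow> real" where
  "delaunay_potential x = (SUP y. y \<bullet> x - voronoi_potential y)"

text \<open>Up to the constant \<open>|x|\<^sup>2 / 2\<close> the function to be maximised is \<open>(d(y,\<Gamma>)\<^sup>2 - |y - x|\<^sup>2) / 2\<close>. As \<open>d(y,\<Gamma>)\<close>
  is bounded by the covering radius \<open>R\<close>, its values outside \<open>cball x R\<close> do not exceed the one at \<open>x\<close>,
  so the supremum is attained on that ball.\<close>

lemma delaunay_potential_maximiser:
  shows "\<exists>q. delaunay_potential x = q \<bullet> x - voronoi_potential q"
    and "y \<bullet> x - voronoi_potential y \<le> delaunay_potential x"
proof -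
  let ?G = "\<lambda>y. y \<bullet> x - voronoi_potential y"
  obtain R where R: "\<And>y. \<exists>\<xi>\<in>\<Gamma>. dist y \<xi> \<le> R"
    using relatively_dense by blast
  have inf: "infdist y \<Gamma> \<le> R" for y
    using R[of y] infdist_le order_trans by blast
  have G: "?G y = ((norm x)\<^sup>2 + (infdist y \<Gamma>)\<^sup>2 - (dist y x)\<^sup>2) / 2" for y
    by (simp add: voronoi_potential_def dist_norm power2_norm_eq_inner inner_diff inner_commute field_simps)
  have "R \<ge> 0"
    using inf infdist_nonneg order_trans by blast
  moreover have "continuous_on (cball x R) ?G"
    by (intro continuous_intros continuous_on_voronoi_potential)
  ultimately obtain q where q: "q \<in> cball x R" "\<And>y. y \<in> cball x R \<Longrightarrow> ?G y \<le> ?G q"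
    using continuous_attains_sup[of "cball x R" ?G] by force
  have max: "?G y \<le> ?G q" for y
  proof (cases "dist y x \<le> R")
    case False
    then have "(infdist y \<Gamma>)\<^sup>2 \<le> (dist y x)\<^sup>2"
      using inf[of y] infdist_nonneg by (intro power_mono) auto
    then have "?G y \<le> ?G x"
      unfolding G by (simp add: add_increasing2)
    also have "\<dots> \<le> ?G q"
      using \<open>R \<ge> 0\<close> by (intro q) simp
    finally show ?thesis .
  qed (use q in \<open>simp add: dist_commute\<close>)
  then have "delaunay_potential x = ?G q"
    unfolding delaunay_potential_def by (intro cSup_eq_maximum) auto
  then show "\<exists>q. delaunay_potential x = q \<bullet> x - voronoi_potential q" "y \<bullet> x - voronoi_potential y \<le> delaunay_potential x"
    using max by auto
qed

text \<open>The affine functions of the sites nearest to \<open>p\<close> all have the value \<open>h p\<close> at \<open>p\<close>. At any other point \<open>q\<close>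
  they stay below \<open>h q\<close>, and this comparison, being affine in the site, passes to convex combinations.\<close>

lemma delaunay_potential_on_Del:
  assumes "x \<in> Del \<Gamma> p"
  shows "delaunay_potential x = p \<bullet> x - voronoi_potential p"
proof (rule antisym)
  obtain q where q: "delaunay_potential x = q \<bullet> x - voronoi_potential q"
    using delaunay_potential_maximiser by blast
  let ?g = "\<lambda>z. voronoi_potential q - voronoi_potential p + (p - q) \<bullet> z"
  have "{\<xi>\<in>\<Gamma>. p \<in> Vor \<Gamma> \<xi>} \<subseteq> {z. (q - p) \<bullet> z \<le> voronoi_potential q - voronoi_potential p}"
  proof clarify
    fix \<xi> assume "\<xi> \<in> \<Gamma>" "p \<in> Vor \<Gamma> \<xi>"
    then show "(q - p) \<bullet> \<xi> \<le> voronoi_potential q - voronoi_potential p"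
      using affine_le_voronoi_potential(1)[of \<xi> q] affine_le_voronoi_potential(2)[of \<xi> p] by (simp add: inner_diff_left)
  qed
  then have "Del \<Gamma> p \<subseteq> {z. (q - p) \<bullet> z \<le> voronoi_potential q - voronoi_potential p}"
    unfolding Del_def by (intro hull_minimal convex_halfspace_le)
  then show "delaunay_potential x \<le> p \<bullet> x - voronoi_potential p"
    using assms q by (auto simp: inner_diff_left)
qed (rule delaunay_potential_maximiser)

lemma nearest_sites_finite: "finite {\<xi>\<in>\<Gamma>. p \<in> Vor \<Gamma> \<xi>}"
  by (rule finite_subset[OF _ locally_finite[of p "infdist p \<Gamma>"]]) (auto simp: Vor_iff_infdist)

text \<open>Sites that are not nearest to \<open>p\<close> are farther away by a fixed gap, since only finitely many lie
  within distance \<open>d(p,\<Gamma>) + 1\<close>; moving \<open>p\<close> by less than half the gap cannot make them nearest.\<close>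

lemma nearest_sites_stable:
  "\<exists>\<delta>>0. \<forall>q \<xi>. dist p q < \<delta> \<longrightarrow> \<xi> \<in> \<Gamma> \<longrightarrow> q \<in> Vor \<Gamma> \<xi> \<longrightarrow> p \<in> Vor \<Gamma> \<xi>"
proof -
  let ?r = "infdist p \<Gamma>"
  define D where "D = dist p ` (\<Gamma> \<inter> cball p (?r + 1)) - {?r}"
  have fin: "finite (insert (?r + 1) D)"
    by (simp add: D_def locally_finite)
  have gt: "d > ?r" if "d \<in> insert (?r + 1) D" for d
    using that infdist_le[of _ \<Gamma> p] by (force simp: D_def)
  define \<delta> where "\<delta> = (Min (insert (?r + 1) D) - ?r) / 2"
  have "Min (insert (?r + 1) D) \<in> insert (?r + 1) D"
    using fin by (intro Min_in) auto
  then have "\<delta> > 0"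
    using gt by (simp add: \<delta>_def)
  moreover have "p \<in> Vor \<Gamma> \<xi>" if q: "dist p q < \<delta>" and \<xi>: "\<xi> \<in> \<Gamma>" "q \<in> Vor \<Gamma> \<xi>" for q \<xi>
  proof (rule ccontr)
    assume "p \<notin> Vor \<Gamma> \<xi>"
    then have ne: "dist p \<xi> \<noteq> ?r"
      using \<xi> Vor_iff_infdist by blast
    have "dist p \<xi> \<le> dist p q + dist q \<xi>"
      by (rule dist_triangle)
    also have "dist q \<xi> = infdist q \<Gamma>"
      using \<xi> Vor_iff_infdist by blast
    also have "infdist q \<Gamma> \<le> ?r + dist q p"
      by (rule infdist_triangle)
    finally have lt: "dist p \<xi> < Min (insert (?r + 1) D)"
      using q by (simp add: \<delta>_def dist_commute)
    moreover have "Min (insert (?r + 1) D) \<le> ?r + 1"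
      using fin by (intro Min_le) auto
    ultimately have "dist p \<xi> \<in> D"
      using \<xi>(1) ne by (auto simp: D_def)
    then have "Min (insert (?r + 1) D) \<le> dist p \<xi>"
      using fin by (intro Min_le) auto
    then show False
      using lt by simp
  qed
  ultimately show ?thesis
    by blast
qed

text \<open>If a hyperplane with normal \<open>a\<close> separates \<open>x\<close> from the Delaunay cell of \<open>p\<close>, then a small step from
  \<open>p\<close> in the direction \<open>-a\<close> increases \<open>y \<bullet> x - h y\<close>: near \<open>p\<close> only the sites nearest to \<open>p\<close> determine \<open>h\<close>.\<close>

lemma maximiser_in_Del:
  assumes "delaunay_potential x = p \<bullet> x - voronoi_potential p"
  shows "x \<in> Del \<Gamma> p"
proof (rule ccontr)
  assume x: "x \<notin> Del \<Gamma> p"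
  have "closed (Del \<Gamma> p)"
    unfolding Del_def using nearest_sites_finite finite_imp_compact_convex_hull compact_imp_closed by blast
  then obtain a b where ab: "a \<bullet> x < b" "\<And>z. z \<in> Del \<Gamma> p \<Longrightarrow> b < a \<bullet> z"
    using separating_hyperplane_closed_point[OF _ _ x] unfolding Del_def
    by (auto simp: convex_convex_hull)
  obtain \<delta> where \<delta>: "\<delta> > 0"
    "\<And>q \<xi>. dist p q < \<delta> \<Longrightarrow> \<xi> \<in> \<Gamma> \<Longrightarrow> q \<in> Vor \<Gamma> \<xi> \<Longrightarrow> p \<in> Vor \<Gamma> \<xi>"
    using nearest_sites_stable by blast
  \<comment> \<open>short enough for the step \<open>t a\<close> to have length below \<open>\<delta>\<close>, even if \<open>a = 0\<close>\<close>
  define t where "t = \<delta> / (norm a + 1)"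
  have t: "t > 0"
    using \<delta>(1) by (simp add: t_def add_nonneg_pos)
  have "norm (t *\<^sub>R a) < \<delta>"
  proof -
    have "norm (t *\<^sub>R a) = \<delta> * (norm a / (norm a + 1))"
      using \<delta>(1) by (simp add: t_def)
    also have "\<dots> < \<delta> * 1"
      using \<delta>(1) by (intro mult_strict_left_mono) (auto simp: add_nonneg_pos)
    finally show ?thesis
      by simp
  qed
  moreover obtain \<xi> where \<xi>: "\<xi> \<in> \<Gamma>" "p - t *\<^sub>R a \<in> Vor \<Gamma> \<xi>"
    using Vor_cover by blast
  ultimately have p: "p \<in> Vor \<Gamma> \<xi>"
    using \<delta>(2)[of "p - t *\<^sub>R a" \<xi>] by (simp add: dist_norm)
  then have "\<xi> \<in> Del \<Gamma> p"
    using \<xi>(1) by (simp add: Del_def hull_inc)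
  then have "t * (a \<bullet> x) < t * (a \<bullet> \<xi>)"
    using ab t by (intro mult_strict_left_mono) force+
  moreover have "(p - t *\<^sub>R a) \<bullet> x - voronoi_potential (p - t *\<^sub>R a) \<le> p \<bullet> x - voronoi_potential p"
    using delaunay_potential_maximiser(2) assms by metis
  moreover have "voronoi_potential p = p \<bullet> \<xi> - (norm \<xi>)\<^sup>2 / 2"
    "voronoi_potential (p - t *\<^sub>R a) = (p - t *\<^sub>R a) \<bullet> \<xi> - (norm \<xi>)\<^sup>2 / 2"
    using \<xi> p affine_le_voronoi_potential(2) by metis+
  ultimately show False
    by (simp add: inner_diff_left)
qed

lemma Vor_convex_closed:
  shows convex_Vor: "convex (Vor \<Gamma> \<xi>)"
    and closed_Vor: "closed (Vor \<Gamma> \<xi>)"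
proof -
  have "Vor \<Gamma> \<xi> = (\<Inter>\<eta>\<in>\<Gamma>. {x. (\<eta> - \<xi>) \<bullet> x \<le> (\<eta> \<bullet> \<eta> - \<xi> \<bullet> \<xi>) / 2})"
    by (auto simp: Vor_def norm_le inner_diff inner_commute algebra_simps)
  then show "convex (Vor \<Gamma> \<xi>)" "closed (Vor \<Gamma> \<xi>)"
    by (simp_all add: convex_INT convex_halfspace_le closed_INT closed_halfspace_le del: le_divide_eq_numeral1)
qed

lemma bounded_Vor:
  assumes "\<xi> \<in> \<Gamma>"
  shows "bounded (Vor \<Gamma> \<xi>)"
proof -
  obtain R where R: "\<And>y. \<exists>\<eta>\<in>\<Gamma>. dist y \<eta> \<le> R"
    using relatively_dense by blast
  have "Vor \<Gamma> \<xi> \<subseteq> cball \<xi> R"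
  proof
    fix y assume "y \<in> Vor \<Gamma> \<xi>"
    then show "y \<in> cball \<xi> R"
      using R[of y] unfolding Vor_def by (auto simp: dist_norm norm_minus_commute intro: order_trans)
  qed
  then show ?thesis
    using bounded_cball bounded_subset by blast
qed

lemma compact_Vor: "\<xi> \<in> \<Gamma> \<Longrightarrow> compact (Vor \<Gamma> \<xi>)"
  using bounded_Vor closed_Vor compact_eq_bounded_closed by blast

text \<open>On the Voronoi cell of a site near a maximiser, \<open>y \<bullet> x - h y\<close> is affine. Its maximisers there form a
  compact face, and an extreme point of a face is a vertex of the cell.\<close>

lemma Del_cover: "\<exists>p\<in>vert_Vor \<Gamma>. x \<in> Del \<Gamma> p"
proof -
  obtain q where q: "delaunay_potential x = q \<bullet> x - voronoi_potential q"
    using delaunay_potential_maximiser by blast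
  obtain \<xi> where \<xi>: "\<xi> \<in> \<Gamma>" "q \<in> Vor \<Gamma> \<xi>"
    using Vor_cover by blast
  define c where "c = delaunay_potential x - (norm \<xi>)\<^sup>2 / 2"
  define F where "F = Vor \<Gamma> \<xi> \<inter> {y. (x - \<xi>) \<bullet> y = c}"
  have vor: "voronoi_potential y = y \<bullet> \<xi> - (norm \<xi>)\<^sup>2 / 2" if "y \<in> Vor \<Gamma> \<xi>" for y
    using that \<xi>(1) affine_le_voronoi_potential(2) by metis
  have face: "F face_of Vor \<Gamma> \<xi>"
    unfolding F_def
  proof (rule face_of_Int_supporting_hyperplane_le[OF convex_Vor])
    fix y assume "y \<in> Vor \<Gamma> \<xi>"
    then show "(x - \<xi>) \<bullet> y \<le> c"
      using vor[of y] delaunay_potential_maximiser(2)[of y x] by (simp add: c_def inner_commute inner_diff_left inner_diff_right)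
  qed
  have "q \<in> F"
    using \<xi> q vor[of q] by (simp add: F_def c_def inner_commute inner_diff_left inner_diff_right)
  moreover have "compact F"
    using face_of_imp_compact[OF convex_Vor compact_Vor[OF \<xi>(1)] face] .
  moreover have "convex F"
    using face_of_imp_convex face by blast
  ultimately obtain p where p: "p extreme_point_of F"
    using extreme_point_exists_convex by blast
  then have "p extreme_point_of Vor \<Gamma> \<xi>" "p \<in> F"
    using extreme_point_of_face[OF face] by blast+
  moreover from this have "delaunay_potential x = p \<bullet> x - voronoi_potential p"
    using vor[of p] by (simp add: F_def c_def inner_commute inner_diff_left inner_diff_right)
  then have "x \<in> Del \<Gamma> p"
    by (rule maximiser_in_Del)
  ultimately show ?thesis
    using \<xi>(1) unfolding vert_Vor_def polytope_vertices_def by blast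
qed

text \<open>The sites nearest to \<open>p\<close> lie on a sphere around \<open>p\<close>, and a sphere contains no point of an open
  segment between points of its ball.\<close>

lemma extreme_points_Del: "polytope_vertices (Del \<Gamma> p) = {\<xi>\<in>\<Gamma>. p \<in> Vor \<Gamma> \<xi>}"
proof
  show "polytope_vertices (Del \<Gamma> p) \<subseteq> {\<xi>\<in>\<Gamma>. p \<in> Vor \<Gamma> \<xi>}"
    unfolding polytope_vertices_def Del_def by (auto dest: extreme_point_of_convex_hull)
  show "{\<xi>\<in>\<Gamma>. p \<in> Vor \<Gamma> \<xi>} \<subseteq> polytope_vertices (Del \<Gamma> p)"
  proof
    fix \<xi> assume \<xi>: "\<xi> \<in> {\<xi>\<in>\<Gamma>. p \<in> Vor \<Gamma> \<xi>}"
    have "{\<xi>\<in>\<Gamma>. p \<in> Vor \<Gamma> \<xi>} \<subseteq> cball p (infdist p \<Gamma>)"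
      by (auto simp: Vor_iff_infdist)
    then have "Del \<Gamma> p \<subseteq> cball p (infdist p \<Gamma>)"
      unfolding Del_def by (simp add: hull_minimal)
    moreover have "dist p \<xi> = infdist p \<Gamma>"
      using \<xi> Vor_iff_infdist by blast
    ultimately have "\<xi> \<notin> open_segment a b" if "a \<in> Del \<Gamma> p" "b \<in> Del \<Gamma> p" for a b
      using that dist_decreases_open_segment[of \<xi> a b p] by fastforce
    moreover have "\<xi> \<in> Del \<Gamma> p"
      using \<xi> by (simp add: Del_def hull_inc)
    ultimately show "\<xi> \<in> polytope_vertices (Del \<Gamma> p)"
      by (simp add: polytope_vertices_def extreme_point_of_def)
  qed
qed

lemma delaunay_affine_formula:
  assumes "\<xi> \<in> \<Gamma>" "p \<in> Vor \<Gamma> \<xi>"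
  shows "(norm \<xi>)\<^sup>2 / 2 + p \<bullet> (x - \<xi>) = p \<bullet> x - voronoi_potential p"
proof -
  have "p \<bullet> \<xi> - (norm \<xi>)\<^sup>2 / 2 = voronoi_potential p"
    using assms affine_le_voronoi_potential(2) by blast
  then show ?thesis
    by (simp add: inner_diff_right)
qed

lemma is_delaunay_function_iff: "is_delaunay_function \<Gamma> w \<longleftrightarrow> w = delaunay_potential"
proof
  assume w: "is_delaunay_function \<Gamma> w"
  show "w = delaunay_potential"
  proof
    fix x
    obtain p where p: "p \<in> vert_Vor \<Gamma>" "x \<in> Del \<Gamma> p"
      using Del_cover[of x] by blast
    obtain \<xi> where \<xi>: "\<xi> \<in> \<Gamma>" "p \<in> Vor \<Gamma> \<xi>"
      using Vor_cover by blast
    then have "w x = (norm \<xi>)\<^sup>2 / 2 + p \<bullet> (x - \<xi>)"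
      using w p unfolding is_delaunay_function_def by blast
    then show "w x = delaunay_potential x"
      using delaunay_potential_on_Del[OF p(2)] delaunay_affine_formula[OF \<xi>, of x] by linarith
  qed
next
  assume "w = delaunay_potential"
  then show "is_delaunay_function \<Gamma> w"
    unfolding is_delaunay_function_def using delaunay_potential_on_Del delaunay_affine_formula by metis
qed

lemma delaunay_potential_on_sites:
  assumes "\<xi> \<in> \<Gamma>"
  shows "delaunay_potential \<xi> = (norm \<xi>)\<^sup>2 / 2"
proof -
  have "\<xi> \<in> Vor \<Gamma> \<xi>"
    by (simp add: Vor_def)
  moreover from this have "\<xi> \<in> Del \<Gamma> \<xi>"
    using assms by (simp add: Del_def hull_inc)
  ultimately show ?thesis
    using delaunay_potential_on_Del[of \<xi> \<xi>] delaunay_affine_formula[OF assms, of \<xi> \<xi>] by simp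
qed

text \<open>The equality case of the inequality between a function and its conjugate. For the forward direction
  it suffices to test the supporting plane at a site whose cell contains \<open>q\<close>.\<close>

lemma subdifferential_delaunay_potential:
  "q \<in> subdifferential delaunay_potential x \<longleftrightarrow> delaunay_potential x = q \<bullet> x - voronoi_potential q"
proof
  assume q: "q \<in> subdifferential delaunay_potential x"
  obtain \<xi> where \<xi>: "\<xi> \<in> \<Gamma>" "q \<in> Vor \<Gamma> \<xi>"
    using Vor_cover by blast
  have "delaunay_potential x + q \<bullet> (\<xi> - x) \<le> (norm \<xi>)\<^sup>2 / 2"
    using q unfolding subdifferential_def delaunay_potential_on_sites[OF \<xi>(1), symmetric] by simp
  then show "delaunay_potential x = q \<bullet> x - voronoi_potential q"
    using delaunay_affine_formula[OF \<xi>, of x] delaunay_potential_maximiser(2)[of q x] by (simp add: inner_diff_right)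
next
  assume x: "delaunay_potential x = q \<bullet> x - voronoi_potential q"
  have "delaunay_potential x + q \<bullet> (y - x) \<le> delaunay_potential y" for y
    using x delaunay_potential_maximiser(2)[of q y] by (simp add: inner_diff_right)
  then show "q \<in> subdifferential delaunay_potential x"
    by (simp add: subdifferential_def)
qed

lemma subdifferential_delaunay_potential_site:
  assumes "\<xi> \<in> \<Gamma>"
  shows "subdifferential delaunay_potential \<xi> = Vor \<Gamma> \<xi>"
proof (rule set_eqI)
  fix q
  have "q \<in> subdifferential delaunay_potential \<xi> \<longleftrightarrow> q \<bullet> \<xi> - (norm \<xi>)\<^sup>2 / 2 = voronoi_potential q"
    unfolding subdifferential_delaunay_potential delaunay_potential_on_sites[OF assms] by linarith
  then show "q \<in> subdifferential delaunay_potential \<xi> \<longleftrightarrow> q \<in> Vor \<Gamma> \<xi>"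
    using affine_le_voronoi_potential(2)[OF assms] by blast
qed

text \<open>A point that is not a site but lies in the hull of the nearest sites of \<open>q\<close> forces \<open>q\<close> to have at
  least two nearest sites.\<close>

lemma subdifferential_off_sites:
  assumes "x \<notin> \<Gamma>" "q \<in> subdifferential delaunay_potential x"
  obtains \<xi> \<eta> where "\<xi> \<in> \<Gamma>" "\<eta> \<in> \<Gamma>" "\<xi> \<noteq> \<eta>" "q \<in> Vor \<Gamma> \<xi> \<inter> Vor \<Gamma> \<eta>"
proof -
  have x: "x \<in> convex hull {\<xi>\<in>\<Gamma>. q \<in> Vor \<Gamma> \<xi>}"
    using maximiser_in_Del assms(2) unfolding subdifferential_delaunay_potential Del_def by blast
  obtain \<xi> where \<xi>: "\<xi> \<in> \<Gamma>" "q \<in> Vor \<Gamma> \<xi>"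
    using Vor_cover by blast
  have "{\<xi>\<in>\<Gamma>. q \<in> Vor \<Gamma> \<xi>} \<noteq> {\<xi>}"
  proof
    assume "{\<xi>\<in>\<Gamma>. q \<in> Vor \<Gamma> \<xi>} = {\<xi>}"
    then have "x = \<xi>"
      using x by (simp only: convex_hull_singleton singleton_iff)
    then show False
      using \<xi>(1) assms(1) by blast
  qed
  then show thesis
    using that \<xi> by blast
qed

lemma negligible_Vor_Int:
  assumes "\<xi> \<noteq> \<eta>" "\<xi> \<in> \<Gamma>" "\<eta> \<in> \<Gamma>"
  shows "negligible (Vor \<Gamma> \<xi> \<inter> Vor \<Gamma> \<eta>)"
proof (rule negligible_subset)
  show "negligible {x. (\<eta> - \<xi>) \<bullet> x = ((norm \<eta>)\<^sup>2 - (norm \<xi>)\<^sup>2) / 2}"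
    using assms by (intro negligible_hyperplane) auto
  show "Vor \<Gamma> \<xi> \<inter> Vor \<Gamma> \<eta> \<subseteq> {x. (\<eta> - \<xi>) \<bullet> x = ((norm \<eta>)\<^sup>2 - (norm \<xi>)\<^sup>2) / 2}"
  proof clarify
    fix x assume "x \<in> Vor \<Gamma> \<xi>" "x \<in> Vor \<Gamma> \<eta>"
    then have "x \<bullet> \<xi> - (norm \<xi>)\<^sup>2 / 2 = x \<bullet> \<eta> - (norm \<eta>)\<^sup>2 / 2"
      using affine_le_voronoi_potential(2) assms by metis
    then show "(\<eta> - \<xi>) \<bullet> x = ((norm \<eta>)\<^sup>2 - (norm \<xi>)\<^sup>2) / 2"
      by (simp add: inner_diff_left inner_commute[of x] diff_divide_distrib)
  qed
qed

lemma negligible_subdifferential_off_sites: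
  "negligible (subdifferential_image delaunay_potential (- \<Gamma>))"
proof (rule negligible_subset)
  let ?P = "\<lambda>(\<xi>, \<eta>). Vor \<Gamma> \<xi> \<inter> Vor \<Gamma> \<eta>"
  show "negligible (\<Union> (?P ` (\<Gamma> \<times> \<Gamma> - Id)))"
    using negligible_Vor_Int countable_sites
    by (intro negligible_countable_Union countable_image countable_Diff countable_SIGMA) auto
  show "subdifferential_image delaunay_potential (- \<Gamma>) \<subseteq> \<Union> (?P ` (\<Gamma> \<times> \<Gamma> - Id))"
  proof
    fix q assume "q \<in> subdifferential_image delaunay_potential (- \<Gamma>)"
    then obtain x where "x \<notin> \<Gamma>" "q \<in> subdifferential delaunay_potential x"
      unfolding subdifferential_image_def by blast
    then obtain \<xi> \<eta> where "\<xi> \<in> \<Gamma>" "\<eta> \<in> \<Gamma>" "\<xi> \<noteq> \<eta>" "q \<in> Vor \<Gamma> \<xi> \<inter> Vor \<Gamma> \<eta>"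
      using subdifferential_off_sites by blast
    then show "q \<in> \<Union> (?P ` (\<Gamma> \<times> \<Gamma> - Id))"
      by (intro UN_I[of "(\<xi>, \<eta>)"]) auto
  qed
qed

lemma subdifferential_delaunay_potential_nonempty: "subdifferential delaunay_potential x \<noteq> {}"
  using subdifferential_delaunay_potential delaunay_potential_maximiser(1) by blast

text \<open>Supporting planes at \<open>\<xi>\<close> are tested at sites only, where \<open>v\<close> and the Delaunay potential agree.\<close>

lemma subdifferential_interpolant_subset_Vor:
  assumes val: "\<And>\<xi>. \<xi> \<in> \<Gamma> \<Longrightarrow> v \<xi> = (norm \<xi>)\<^sup>2 / 2" and "\<xi> \<in> \<Gamma>"
  shows "subdifferential v \<xi> \<subseteq> Vor \<Gamma> \<xi>"
proof
  fix q assume q: "q \<in> subdifferential v \<xi>"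
  obtain \<eta> where \<eta>: "\<eta> \<in> \<Gamma>" "q \<in> Vor \<Gamma> \<eta>"
    using Vor_cover by blast
  have "v \<xi> + q \<bullet> (\<eta> - \<xi>) \<le> v \<eta>"
    using q by (simp add: subdifferential_def)
  then have "voronoi_potential q \<le> q \<bullet> \<xi> - (norm \<xi>)\<^sup>2 / 2"
    using delaunay_affine_formula[OF \<eta>, of \<xi>] val assms(2) \<eta>(1) by (simp add: inner_diff_right)
  then show "q \<in> Vor \<Gamma> \<xi>"
    using affine_le_voronoi_potential[OF assms(2), of q] by linarith
qed

text \<open>The upper bound is convexity on a Delaunay cell. For the lower bound, every slope outside a null set
  belongs to a supporting plane of \<open>v\<close> at some site, and such a plane is one of the affine functions
  whose supremum is the Delaunay potential. The remaining slopes are limits of these.\<close>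

lemma convex_interpolant_eq_delaunay_potential:
  assumes conv: "convex_on UNIV v"
    and val: "\<And>\<xi>. \<xi> \<in> \<Gamma> \<Longrightarrow> v \<xi> = (norm \<xi>)\<^sup>2 / 2"
    and full: "\<And>\<xi>. \<xi> \<in> \<Gamma> \<Longrightarrow> negligible (Vor \<Gamma> \<xi> - subdifferential v \<xi>)"
  shows "v = delaunay_potential"
proof
  fix x
  have "v x \<le> delaunay_potential x"
  proof -
    obtain p where p: "p \<in> vert_Vor \<Gamma>" "x \<in> Del \<Gamma> p"
      using Del_cover[of x] by blast
    have "convex_on UNIV (\<lambda>z. - (p \<bullet> z))"
      by (simp add: convex_on_def inner_simps)
    then have "convex_on (convex hull {\<xi>\<in>\<Gamma>. p \<in> Vor \<Gamma> \<xi>}) (\<lambda>z. v z + - (p \<bullet> z))"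
      using convex_on_add[OF conv] convex_on_subset[OF _ subset_UNIV convex_convex_hull] by blast
    moreover have "v \<xi> + - (p \<bullet> \<xi>) \<le> - voronoi_potential p" if "\<xi> \<in> \<Gamma>" "p \<in> Vor \<Gamma> \<xi>" for \<xi>
      using delaunay_affine_formula[OF that, of 0] val[OF that(1)] by simp
    ultimately have "v x + - (p \<bullet> x) \<le> - voronoi_potential p"
      using convex_on_convex_hull_bound p(2) unfolding Del_def by blast
    then show ?thesis
      using delaunay_potential_on_Del[OF p(2)] by simp
  qed
  moreover have "delaunay_potential x \<le> v x"
  proof -
    \<comment> \<open>the admissible slopes: a closed set whose complement turns out to be open and null, hence empty\<close>
    define S where "S = {q. q \<bullet> x - voronoi_potential q \<le> v x}"
    have "closed S"
      unfolding S_def by (intro closed_Collect_le continuous_intros continuous_on_voronoi_potential)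
    have sub: "- S \<subseteq> (\<Union>\<xi>\<in>\<Gamma>. Vor \<Gamma> \<xi> - subdifferential v \<xi>)"
    proof
      fix q assume "q \<in> - S"
      obtain \<xi> where \<xi>: "\<xi> \<in> \<Gamma>" "q \<in> Vor \<Gamma> \<xi>"
        using Vor_cover by blast
      have "q \<notin> subdifferential v \<xi>"
      proof
        assume "q \<in> subdifferential v \<xi>"
        then have "v \<xi> + q \<bullet> (x - \<xi>) \<le> v x"
          by (simp add: subdifferential_def)
        then show False
          using \<open>q \<in> - S\<close> val[OF \<xi>(1)] delaunay_affine_formula[OF \<xi>, of x] by (simp add: S_def)
      qed
      then show "q \<in> (\<Union>\<xi>\<in>\<Gamma>. Vor \<Gamma> \<xi> - subdifferential v \<xi>)"
        using \<xi> by blast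
    qed
    have "negligible (\<Union>\<xi>\<in>\<Gamma>. Vor \<Gamma> \<xi> - subdifferential v \<xi>)"
      using full countable_sites by (intro negligible_countable_Union countable_image) auto
    then have "negligible (- S)"
      using sub negligible_subset by blast
    then have "- S = {}"
      using \<open>closed S\<close> open_not_negligible by (metis open_Compl)
    then have "S = UNIV"
      by blast
    then show ?thesis
      using delaunay_potential_maximiser(1)[of x] by (auto simp: S_def)
  qed
  ultimately show "v x = delaunay_potential x"
    by simp
qed

end

section \<open>Lattices\<close>

lemma finite_int_lattice_norm_le: "finite {z \<in> int_lattice. norm (z :: real ^ 'n) \<le> r}"
proof (rule finite_subset)
  let ?F = "PiE (UNIV :: 'n set) (\<lambda>_. {- \<lceil>r\<rceil>..\<lceil>r\<rceil>})"
  show "{z \<in> int_lattice. norm (z :: real ^ 'n) \<le> r} \<subseteq> (\<lambda>f. \<chi> i. real_of_int (f i)) ` ?F"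
  proof
    fix z :: "real ^ 'n"
    assume z: "z \<in> {z \<in> int_lattice. norm z \<le> r}"
    have "\<lfloor>z $ i\<rfloor> \<in> {- \<lceil>r\<rceil>..\<lceil>r\<rceil>}" for i
    proof -
      have "\<bar>z $ i\<bar> \<le> r"
        using z component_le_norm_cart[of z i] by simp
      then show ?thesis
        by (auto simp: le_floor_iff floor_le_iff) linarith+
    qed
    moreover have "z = (\<chi> i. real_of_int \<lfloor>z $ i\<rfloor>)"
      using z by (auto simp: int_lattice_def vec_eq_iff elim!: Ints_cases)
    ultimately show "z \<in> (\<lambda>f. \<chi> i. real_of_int (f i)) ` ?F"
      by (intro image_eqI[of _ _ "\<lambda>i. \<lfloor>z $ i\<rfloor>"]) auto
  qed
  show "finite ((\<lambda>f. \<chi> i. real_of_int (f i) :: real ^ 'n) ` ?F)"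
    by (intro finite_imageI finite_PiE) auto
qed

lemma int_lattice_group:
  "0 \<in> int_lattice"
  "x \<in> int_lattice \<Longrightarrow> y \<in> int_lattice \<Longrightarrow> x + y \<in> int_lattice"
  "x \<in> int_lattice \<Longrightarrow> - x \<in> int_lattice"
  by (auto simp: int_lattice_def)

definition round_down :: "real ^ 'n \<Rightarrow> real ^ 'n" where
  "round_down x = (\<chi> i. of_int \<lfloor>x $ i\<rfloor>)"

lemma round_down:
  "round_down x \<in> int_lattice" "x - round_down x \<in> cbox 0 1"
  by (auto simp: round_down_def int_lattice_def mem_box_cart less_imp_le) linarith

lemma negligible_unit_cube_overlap:
  fixes z z' :: "real ^ 'n"
  assumes "z \<noteq> z'" "z \<in> int_lattice" "z' \<in> int_lattice"
  shows "negligible ((+) z ` cbox 0 1 \<inter> (+) z' ` cbox 0 1)"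
proof -
  obtain i where i: "z $ i \<noteq> z' $ i"
    using assms(1) by (auto simp: vec_eq_iff)
  obtain k k' where k: "z $ i = of_int k" "z' $ i = of_int k'"
    using assms(2,3) unfolding int_lattice_def by (metis (mono_tags) Ints_cases mem_Collect_eq)
  have *: "x $ i = max (z $ i) (z' $ i)" if "x \<in> (+) z ` cbox 0 1 \<inter> (+) z' ` cbox 0 1" for x
  proof -
    have "z $ i \<le> x $ i" "x $ i \<le> z $ i + 1" "z' $ i \<le> x $ i" "x $ i \<le> z' $ i + 1"
      using that by (auto simp: mem_box_cart cbox_translation[symmetric])
    moreover have "k + 1 \<le> k' \<or> k' + 1 \<le> k"
      using i k by fastforce
    then have "z $ i + 1 \<le> z' $ i \<or> z' $ i + 1 \<le> z $ i"
      unfolding k by (metis of_int_1 of_int_add of_int_le_iff)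
    ultimately show ?thesis
      by linarith
  qed
  have "negligible {x :: real ^ 'n. axis i 1 \<bullet> x = max (z $ i) (z' $ i)}"
    by (intro negligible_hyperplane) (simp add: axis_eq_0_iff)
  then show ?thesis
    by (rule negligible_subset) (auto simp: inner_axis' dest!: *)
qed

locale lattice_basis =
  fixes B :: "real ^ 'n ^ 'n" and \<Gamma> :: "(real ^ 'n) set"
  assumes det_nonzero: "det B \<noteq> 0"
    and \<Gamma>_eq: "\<Gamma> = (*v) B ` int_lattice"
begin

definition B_inv :: "real ^ 'n ^ 'n" where "B_inv = matrix_inv B"

lemma B_inv_cancel [simp]: "B *v (B_inv *v x) = x" "B_inv *v (B *v x) = x"
proof -
  have "invertible B"
    using det_nonzero invertible_det_nz by blast
  then show "B *v (B_inv *v x) = x" "B_inv *v (B *v x) = x"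
    using someI_ex[of "\<lambda>C. B ** C = mat 1 \<and> C ** B = mat 1"]
    by (simp_all add: B_inv_def matrix_inv_def invertible_def matrix_vector_mul_assoc)
qed

lemma inj_B: "inj ((*v) B)"
  by (metis B_inv_cancel(2) injI)

lemma subgroup_sites:
  shows zero_site: "0 \<in> \<Gamma>"
    and add_site: "\<xi> \<in> \<Gamma> \<Longrightarrow> \<eta> \<in> \<Gamma> \<Longrightarrow> \<xi> + \<eta> \<in> \<Gamma>"
    and uminus_site: "\<xi> \<in> \<Gamma> \<Longrightarrow> - \<xi> \<in> \<Gamma>"
proof -
  show "0 \<in> \<Gamma>"
    unfolding \<Gamma>_eq by (rule image_eqI[of _ _ 0]) (auto simp: int_lattice_group)
  show "\<xi> + \<eta> \<in> \<Gamma>" if "\<xi> \<in> \<Gamma>" "\<eta> \<in> \<Gamma>"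
    using that int_lattice_group(2) unfolding \<Gamma>_eq
    by (auto simp: matrix_vector_right_distrib[symmetric] intro!: imageI)
  show "- \<xi> \<in> \<Gamma>" if "\<xi> \<in> \<Gamma>"
    using that int_lattice_group(3) unfolding \<Gamma>_eq
    by (auto simp: linear_neg[OF matrix_vector_mul_linear, symmetric] intro!: imageI)
qed

sublocale delone_set \<Gamma>
proof
  show "finite (\<Gamma> \<inter> cball x r)" for x r
  proof -
    obtain K where K: "\<And>y. norm (B_inv *v y) \<le> K * norm y" "K > 0"
      using linear_bounded_pos[OF matrix_vector_mul_linear, of B_inv] by (metis mult.commute)
    have "\<Gamma> \<inter> cball x r \<subseteq> (*v) B ` {z \<in> int_lattice. norm z \<le> K * (norm x + r)}"
    proof
      fix y assume y: "y \<in> \<Gamma> \<inter> cball x r"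
      then obtain z where z: "y = B *v z" "z \<in> int_lattice"
        unfolding \<Gamma>_eq by blast
      have "norm y \<le> norm x + r"
        using y norm_triangle_ineq2[of y x] by (simp add: dist_norm norm_minus_commute)
      moreover have "norm z \<le> K * norm y"
        using K(1)[of y] z by simp
      ultimately have "norm z \<le> K * (norm x + r)"
        using K(2) by (meson less_imp_le mult_left_mono order_trans)
      then show "y \<in> (*v) B ` {z \<in> int_lattice. norm z \<le> K * (norm x + r)}"
        using z by blast
    qed
    then show ?thesis
      using finite_int_lattice_norm_le finite_surj by blast
  qed
  obtain R where R: "\<And>y. y \<in> (*v) B ` cbox 0 1 \<Longrightarrow> norm y \<le> R"
    using bounded_linear_image[OF bounded_cbox matrix_vector_mul_bounded_linear]
    unfolding bounded_iff by blast
  have "\<exists>\<xi>\<in>\<Gamma>. dist x \<xi> \<le> R" for x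
  proof
    let ?z = "round_down (B_inv *v x)"
    show "B *v ?z \<in> \<Gamma>"
      unfolding \<Gamma>_eq using round_down(1) by blast
    have "x - B *v ?z = B *v (B_inv *v x - ?z)"
      by (simp add: matrix_vector_mult_diff_distrib)
    then show "dist x (B *v ?z) \<le> R"
      using R[OF imageI[OF round_down(2)]] by (simp add: dist_norm)
  qed
  then show "\<exists>R. \<forall>x. \<exists>\<xi>\<in>\<Gamma>. dist x \<xi> \<le> R"
    by blast
qed

lemma Vor_translate:
  assumes "\<xi> \<in> \<Gamma>"
  shows "Vor \<Gamma> \<xi> = (+) \<xi> ` Vor \<Gamma> 0"
proof -
  have shift: "(+) \<xi> ` \<Gamma> = \<Gamma>"
  proof
    show "(+) \<xi> ` \<Gamma> \<subseteq> \<Gamma>"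
      using add_site[OF assms] by blast
    show "\<Gamma> \<subseteq> (+) \<xi> ` \<Gamma>"
    proof
      fix \<eta> assume "\<eta> \<in> \<Gamma>"
      then have "- \<xi> + \<eta> \<in> \<Gamma>"
        using assms add_site uminus_site by blast
      then show "\<eta> \<in> (+) \<xi> ` \<Gamma>"
        by (rule rev_image_eqI) simp
    qed
  qed
  have "y \<in> Vor \<Gamma> \<xi> \<longleftrightarrow> y - \<xi> \<in> Vor \<Gamma> 0" for y
  proof -
    have "y \<in> Vor \<Gamma> \<xi> \<longleftrightarrow> (\<forall>\<eta>\<in>(+) \<xi> ` \<Gamma>. norm (y - \<xi>) \<le> norm (y - \<eta>))"
      unfolding Vor_def shift by simp
    then show ?thesis
      by (simp add: Vor_def diff_diff_add)
  qed
  then show ?thesis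
    by (force simp: image_iff)
qed

lemma lmeasurable_Vor: "\<xi> \<in> \<Gamma> \<Longrightarrow> Vor \<Gamma> \<xi> \<in> lmeasurable"
  by (simp add: compact_Vor lmeasurable_compact)

text \<open>The Voronoi cell and the fundamental parallelepiped tile space under the same lattice.\<close>

lemma measure_Vor:
  assumes "\<xi> \<in> \<Gamma>"
  shows "measure lebesgue (Vor \<Gamma> \<xi>) = \<bar>det B\<bar>"
proof -
  let ?T = "(*v) B ` cbox 0 1"
  have shift: "(+) (B *v z) ` ?T = (*v) B ` ((+) z ` cbox 0 1)" for z
    by (simp add: image_image matrix_vector_right_distrib)
  have "emeasure lebesgue (Vor \<Gamma> 0) = emeasure lebesgue ?T"
  proof (rule emeasure_tiles_eq[OF countable_sites uminus_site])
    show "Vor \<Gamma> 0 \<in> sets lebesgue"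
      using lmeasurable_Vor[OF zero_site] by blast
    show "(\<Union>\<gamma>\<in>\<Gamma>. (+) \<gamma> ` Vor \<Gamma> 0) = UNIV"
      using Vor_cover Vor_translate by fast
    show "negligible ((+) \<gamma> ` Vor \<Gamma> 0 \<inter> (+) \<delta> ` Vor \<Gamma> 0)"
      if "\<gamma> \<in> \<Gamma>" "\<delta> \<in> \<Gamma>" "\<gamma> \<noteq> \<delta>" for \<gamma> \<delta>
      using negligible_Vor_Int that by (simp add: Vor_translate[symmetric])
    show "?T \<in> sets lebesgue"
      using lmeasurable_linear_image[OF matrix_vector_mul_linear lmeasurable_cbox] by blast
    show "(\<Union>\<gamma>\<in>\<Gamma>. (+) \<gamma> ` ?T) = UNIV"
    proof -
      have "x \<in> (\<Union>\<gamma>\<in>\<Gamma>. (+) \<gamma> ` ?T)" for x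
      proof -
        let ?z = "round_down (B_inv *v x)"
        have "x = B *v ?z + B *v (B_inv *v x - ?z)"
          by (simp add: matrix_vector_mult_diff_distrib)
        then show ?thesis
          using round_down unfolding \<Gamma>_eq by blast
      qed
      then show ?thesis
        by blast
    qed
    show "negligible ((+) \<gamma> ` ?T \<inter> (+) \<delta> ` ?T)"
      if "\<gamma> \<in> \<Gamma>" "\<delta> \<in> \<Gamma>" "\<gamma> \<noteq> \<delta>" for \<gamma> \<delta>
    proof -
      obtain z z' where z: "\<gamma> = B *v z" "\<delta> = B *v z'" "z \<in> int_lattice" "z' \<in> int_lattice"
        using \<open>\<gamma> \<in> \<Gamma>\<close> \<open>\<delta> \<in> \<Gamma>\<close> unfolding \<Gamma>_eq by blast
      then have "z \<noteq> z'"
        using \<open>\<gamma> \<noteq> \<delta>\<close> by blast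
      from negligible_unit_cube_overlap[OF this z(3,4)] show ?thesis
        unfolding z shift image_Int[OF inj_B, symmetric]
        by (rule negligible_linear_image[OF matrix_vector_mul_linear])
    qed
  qed
  then have "measure lebesgue (Vor \<Gamma> 0) = measure lebesgue ?T"
    by (simp add: measure_def)
  also have "\<dots> = \<bar>det B\<bar> * measure lebesgue (cbox 0 (1 :: real ^ 'n))"
    by (simp add: measure_lebesgue_linear_image[OF matrix_vector_mul_linear])
  also have "measure lebesgue (cbox 0 (1 :: real ^ 'n)) = 1"
    by (simp add: content_cbox_if_cart interval_eq_empty_cart)
  finally show ?thesis
    using assms by (simp add: Vor_translate measure_translation)
qed

lemma voronoi_potential_translate:
  assumes "\<gamma> \<in> \<Gamma>"
  shows "voronoi_potential (y + \<gamma>) = voronoi_potential y + y \<bullet> \<gamma> + (norm \<gamma>)\<^sup>2 / 2"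
proof -
  have le: "infdist (y + \<delta>) \<Gamma> \<le> infdist y \<Gamma>" if "\<delta> \<in> \<Gamma>" for y \<delta>
  proof -
    obtain \<xi> where \<xi>: "\<xi> \<in> \<Gamma>" "infdist y \<Gamma> = dist y \<xi>"
      using nearest_site_exists by blast
    have "infdist (y + \<delta>) \<Gamma> \<le> dist (y + \<delta>) (\<xi> + \<delta>)"
      by (intro infdist_le add_site \<xi>(1) that)
    then show ?thesis
      using \<xi>(2) by simp
  qed
  have "infdist (y + \<gamma>) \<Gamma> = infdist y \<Gamma>"
    using le[OF assms, of y] le[OF uminus_site[OF assms], of "y + \<gamma>"] by simp
  then show ?thesis
    by (simp add: voronoi_potential_def power2_norm_eq_inner inner_simps inner_commute field_simps)
qed

text \<open>A maximiser \<open>q\<close> at \<open>x\<close> gives the competitor \<open>q + \<gamma>\<close> at \<open>x + \<gamma>\<close>, hence one inequality; the opposite one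
  is the same statement for \<open>-\<gamma>\<close>.\<close>

lemma delaunay_potential_translate:
  assumes "\<gamma> \<in> \<Gamma>"
  shows "delaunay_potential (x + \<gamma>) = delaunay_potential x + \<gamma> \<bullet> x + (norm \<gamma>)\<^sup>2 / 2"
proof -
  have le: "delaunay_potential x + \<delta> \<bullet> x + (norm \<delta>)\<^sup>2 / 2 \<le> delaunay_potential (x + \<delta>)" if "\<delta> \<in> \<Gamma>" for x \<delta>
  proof -
    obtain q where "delaunay_potential x = q \<bullet> x - voronoi_potential q"
      using delaunay_potential_maximiser by blast
    then show ?thesis
      using delaunay_potential_maximiser(2)[of "q + \<delta>" "x + \<delta>"]
      by (simp add: voronoi_potential_translate[OF that] inner_simps power2_norm_eq_inner inner_commute)
  qed
  show ?thesis
    using le[OF assms, of x] le[OF uminus_site[OF assms], of "x + \<gamma>"]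
    by (simp add: inner_simps power2_norm_eq_inner inner_commute)
qed

end

section \<open>The Alexandrov solution of a lattice\<close>

text \<open>Symmetry makes \<open>B\<close> its own adjoint, so that subgradients transform by \<open>B\<close> itself and \<open>B\<^sup>2\<close> is the
  matrix of the quadratic form \<open>|B x|\<^sup>2\<close>; the determinant condition normalises the cells to volume one.\<close>

locale unimodular_symmetric_basis = lattice_basis B \<Gamma>
  for B :: "real ^ 'n ^ 'n" and \<Gamma> +
  assumes symmetric: "transpose B = B" and unimodular: "\<bar>det B\<bar> = 1"
begin

lemma subdifferential_compose:
  "subdifferential (\<lambda>x. f (B *v x)) x = (*v) B ` subdifferential f (B *v x)"
  using subdifferential_compose_matrix[OF det_nonzero, of f x] unfolding symmetric .

lemma basis_site: "z \<in> int_lattice \<Longrightarrow> B *v z \<in> \<Gamma>"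
  unfolding \<Gamma>_eq by blast

text \<open>These sets will be the subdifferentials of the solution at lattice points. One factor \<open>|det B|\<close> of
  their volume is the covolume of \<open>\<Gamma>\<close>, the other comes from the map \<open>B\<close>.\<close>

lemma image_cell_measure:
  assumes "z \<in> int_lattice"
  shows "(*v) B ` Vor \<Gamma> (B *v z) \<in> sets lebesgue"
    "emeasure lebesgue ((*v) B ` Vor \<Gamma> (B *v z)) = 1"
proof -
  note lin = matrix_vector_mul_linear[of B]
  note V = lmeasurable_Vor[OF basis_site[OF assms]]
  have m: "(*v) B ` Vor \<Gamma> (B *v z) \<in> lmeasurable"
    by (rule lmeasurable_linear_image[OF lin V])
  then show "(*v) B ` Vor \<Gamma> (B *v z) \<in> sets lebesgue"
    by blast
  have "measure lebesgue ((*v) B ` Vor \<Gamma> (B *v z)) = 1"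
    using measure_Vor[OF basis_site[OF assms]] unimodular
    by (simp add: measure_lebesgue_linear_image[OF lin V])
  then show "emeasure lebesgue ((*v) B ` Vor \<Gamma> (B *v z)) = 1"
    using m by (simp add: emeasure_eq_measure2)
qed

lemma countable_int_lattice: "countable (int_lattice :: (real ^ 'n) set)"
  using countable_sites unfolding \<Gamma>_eq by (metis countable_image_inj_on inj_B inj_on_subset subset_UNIV)

lemma alexandrov_delaunay_potential:
  "alexandrov_solution (\<lambda>x. delaunay_potential (B *v x)) (dirac_sum int_lattice)"
proof (rule alexandrov_solution_dirac_sumI[OF _ countable_int_lattice])
  let ?u = "\<lambda>x. delaunay_potential (B *v x)"
  have at: "subdifferential ?u z = (*v) B ` Vor \<Gamma> (B *v z)" if "z \<in> int_lattice" for z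
    by (simp add: subdifferential_compose subdifferential_delaunay_potential_site basis_site that)
  show "convex_on UNIV ?u"
    by (rule convex_on_if_subdifferential_nonempty)
      (simp add: subdifferential_compose subdifferential_delaunay_potential_nonempty)
  show "subdifferential ?u z \<in> sets lebesgue" "emeasure lebesgue (subdifferential ?u z) = 1"
    if "z \<in> int_lattice" for z
    unfolding at[OF that] by (rule image_cell_measure[OF that])+
  show "negligible (subdifferential ?u y \<inter> subdifferential ?u z)"
    if "y \<in> int_lattice" "z \<in> int_lattice" "y \<noteq> z" for y z
  proof -
    have "B *v y \<noteq> B *v z"
      using \<open>y \<noteq> z\<close> inj_B by (meson injD)
    then show ?thesis
      unfolding at[OF that(1)] at[OF that(2)] image_Int[OF inj_B, symmetric]
      by (intro negligible_linear_image negligible_Vor_Int basis_site that matrix_vector_mul_linear)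
  qed
  show "negligible (subdifferential_image ?u (- int_lattice))"
  proof (rule negligible_subset)
    show "negligible ((*v) B ` subdifferential_image delaunay_potential (- \<Gamma>))"
      by (intro negligible_linear_image negligible_subdifferential_off_sites matrix_vector_mul_linear)
    have "B *v x \<notin> \<Gamma>" if "x \<notin> int_lattice" for x
      using that inj_B unfolding \<Gamma>_eq by (metis imageE injD)
    then show "subdifferential_image ?u (- int_lattice) \<subseteq> (*v) B ` subdifferential_image delaunay_potential (- \<Gamma>)"
      unfolding subdifferential_image_def subdifferential_compose by blast
  qed
qed

lemma quadratic_form: "x \<bullet> ((B ** B) *v x) = (norm (B *v x))\<^sup>2"
proof -
  have "x \<bullet> (B *v (B *v x)) = (transpose B *v x) \<bullet> (B *v x)"
    by (simp add: dot_lmul_matrix)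
  then show ?thesis
    by (simp only: symmetric matrix_vector_mul_assoc[symmetric] power2_norm_eq_inner)
qed

lemma quadratic_part_delaunay_potential:
  "has_quadratic_part (\<lambda>x. delaunay_potential (B *v x)) (B ** B)"
  unfolding has_quadratic_part_def quadratic_form
proof (intro ballI allI)
  fix z x :: "real ^ 'n"
  assume "z \<in> int_lattice"
  from delaunay_potential_translate[OF basis_site[OF this], of "B *v x"]
  show "delaunay_potential (B *v (x + z)) - (norm (B *v (x + z)))\<^sup>2 / 2 = delaunay_potential (B *v x) - (norm (B *v x))\<^sup>2 / 2"
    by (simp add: matrix_vector_right_distrib power2_norm_eq_inner inner_simps inner_commute field_simps)
qed

text \<open>Evaluating the quadratic part at \<open>0\<close> determines \<open>v\<close> on the integer points up to \<open>v 0\<close>. There its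
  subdifferential has volume one and lies in a cell of volume one, so it exhausts the cell up to a
  null set.\<close>

lemma alexandrov_unique:
  assumes v: "alexandrov_solution v (dirac_sum int_lattice)" and quad: "has_quadratic_part v (B ** B)"
  shows "v x = delaunay_potential (B *v x) + v 0"
proof -
  define f where "f y = v (B_inv *v y) - v 0" for y
  have vf: "v = (\<lambda>x. f (B *v x) + v 0)"
    by (simp add: f_def)
  have sub: "subdifferential v z = (*v) B ` subdifferential f (B *v z)" for z
  proof -
    have "subdifferential v z = subdifferential (\<lambda>x. f (B *v x)) z"
      by (simp add: subdifferential_def f_def)
    then show ?thesis
      by (simp only: subdifferential_compose)
  qed
  have val: "f \<xi> = (norm \<xi>)\<^sup>2 / 2" if \<xi>: "\<xi> \<in> \<Gamma>" for \<xi>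
  proof -
    obtain z where z: "z \<in> int_lattice" "\<xi> = B *v z"
      using \<xi> unfolding \<Gamma>_eq by blast
    have "v (0 + z) - (norm (B *v (0 + z)))\<^sup>2 / 2 = v 0 - (norm (B *v 0))\<^sup>2 / 2"
      using quad z(1) unfolding has_quadratic_part_def quadratic_form by blast
    then show ?thesis
      by (simp add: f_def z)
  qed
  have "f = delaunay_potential"
  proof (rule convex_interpolant_eq_delaunay_potential[OF _ val])
    show "convex_on UNIV f"
    proof -
      have "convex_on UNIV v"
        using v by (simp add: alexandrov_solution_def)
      note D = convex_onD[OF this]
      show ?thesis
      proof (intro convex_onI)
        fix t :: real and x y :: "real ^ 'n"
        assume "0 < t" "t < 1"
        then have "v ((1 - t) *\<^sub>R (B_inv *v x) + t *\<^sub>R (B_inv *v y)) \<le> (1 - t) * v (B_inv *v x) + t * v (B_inv *v y)"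
          by (intro D) auto
        then show "f ((1 - t) *\<^sub>R x + t *\<^sub>R y) \<le> (1 - t) * f x + t * f y"
          by (simp add: f_def matrix_vector_right_distrib matrix_vector_mult_scaleR algebra_simps)
      qed simp
    qed
    fix \<xi> assume \<xi>: "\<xi> \<in> \<Gamma>"
    then obtain z where z: "z \<in> int_lattice" "\<xi> = B *v z"
      unfolding \<Gamma>_eq by blast
    let ?P = "(*v) B ` Vor \<Gamma> \<xi>" and ?Q = "subdifferential v z"
    have "{z} \<in> sets borel"
      by simp
    then have "subdifferential_image v {z} \<in> sets lebesgue"
      "emeasure lebesgue (subdifferential_image v {z}) = emeasure (dirac_sum int_lattice) {z}"
      using v unfolding alexandrov_solution_def by blast+
    moreover have "emeasure (dirac_sum int_lattice) {z} = 1"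
    proof -
      have "emeasure (dirac_sum int_lattice) {z} = (\<integral>\<^sup>+y. indicator {z} y \<partial>count_space int_lattice)"
        by (simp add: emeasure_dirac_sum)
      also have "\<dots> = 1"
        using z(1) by simp
      finally show ?thesis .
    qed
    ultimately have Q: "?Q \<in> sets lebesgue" "emeasure lebesgue ?Q = 1"
      by (simp_all add: subdifferential_image_def)
    have P: "?P \<in> sets lebesgue" "emeasure lebesgue ?P = 1"
      using image_cell_measure[OF z(1)] by (simp_all add: z(2))
    have "?Q \<subseteq> ?P"
      unfolding sub z(2)[symmetric] using subdifferential_interpolant_subset_Vor[OF val \<xi>] by blast
    then have "emeasure lebesgue (?P - ?Q) = 0"
      using P Q by (simp add: emeasure_Diff)
    then have "negligible (?P - ?Q)"
      using P(1) Q(1) by (simp add: negligible_iff_emeasure0)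
    then have "negligible ((*v) B_inv ` (?P - ?Q))"
      by (intro negligible_linear_image matrix_vector_mul_linear)
    moreover have "(*v) B_inv ` (?P - ?Q) = Vor \<Gamma> \<xi> - subdifferential f \<xi>"
      unfolding sub z(2)[symmetric] image_set_diff[OF inj_B, symmetric] by (simp add: image_image)
    ultimately show "negligible (Vor \<Gamma> \<xi> - subdifferential f \<xi>)"
      by simp
  qed
  then show ?thesis
    using vf by metis
qed

end

theorem theorem5p6:
  fixes A :: "real ^ 'n ^ 'n" and \<Gamma> :: "(real ^ 'n) set"
  assumes "pos_def_sym A"
    and "det A = 1"
    and "\<Gamma> = (\<lambda>z. matrix_sqrt A *v z) ` int_lattice"
  shows "(\<forall>p\<in>vert_Vor \<Gamma>. {\<xi>\<in>\<Gamma>. p \<in> Vor \<Gamma> \<xi>} = polytope_vertices (Del \<Gamma> p)) \<and>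
    (\<forall>p\<in>vert_Vor \<Gamma>. \<forall>x\<in>Del \<Gamma> p. \<forall>\<xi>\<in>\<Gamma>. \<forall>\<xi>'\<in>\<Gamma>. p \<in> Vor \<Gamma> \<xi> \<longrightarrow> p \<in> Vor \<Gamma> \<xi>' \<longrightarrow>
       (norm \<xi>)\<^sup>2 / 2 + p \<bullet> (x - \<xi>) = (norm \<xi>')\<^sup>2 / 2 + p \<bullet> (x - \<xi>')) \<and>
    (\<exists>!w. is_delaunay_function \<Gamma> w) \<and>
    (\<forall>w u. is_delaunay_function \<Gamma> w \<longrightarrow> u = (\<lambda>x. w (matrix_sqrt A *v x)) \<longrightarrow>
       alexandrov_solution u (dirac_sum int_lattice) \<and> has_quadratic_part u A \<and>
       (\<forall>v. alexandrov_solution v (dirac_sum int_lattice) \<and> has_quadratic_part v A \<longrightarrow>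
          (\<exists>c. \<forall>x. v x = u x + c)))"
proof -
  define B where "B = matrix_sqrt A"
  have B: "transpose B = B" "B ** B = A"
    using matrix_sqrt[OF assms(1)] by (auto simp: B_def pos_def_sym_def)
  have "\<bar>det B\<bar> = 1"
    using B(2) assms(2) det_mul[of B B] by (metis abs_mult_self_eq abs_one abs_square_eq_1 power2_eq_square)
  then interpret unimodular_symmetric_basis B \<Gamma>
    using B(1) assms(3) by unfold_locales (auto simp: B_def)
  show ?thesis
  proof (intro conjI ballI allI impI)
    show "\<exists>!w. is_delaunay_function \<Gamma> w"
      by (simp add: is_delaunay_function_iff)
  next
    fix p assume "p \<in> vert_Vor \<Gamma>"
    show "{\<xi>\<in>\<Gamma>. p \<in> Vor \<Gamma> \<xi>} = polytope_vertices (Del \<Gamma> p)"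
      by (simp add: extreme_points_Del)
  next
    fix p x \<xi> \<xi>' assume "\<xi> \<in> \<Gamma>" "\<xi>' \<in> \<Gamma>" "p \<in> Vor \<Gamma> \<xi>" "p \<in> Vor \<Gamma> \<xi>'"
    then show "(norm \<xi>)\<^sup>2 / 2 + p \<bullet> (x - \<xi>) = (norm \<xi>')\<^sup>2 / 2 + p \<bullet> (x - \<xi>')"
      by (simp add: delaunay_affine_formula)
  next
    fix w u assume "is_delaunay_function \<Gamma> w" "u = (\<lambda>x. w (matrix_sqrt A *v x))"
    then have u: "u = (\<lambda>x. delaunay_potential (B *v x))"
      by (simp add: is_delaunay_function_iff B_def)
    show "alexandrov_solution u (dirac_sum int_lattice)"
      unfolding u by (rule alexandrov_delaunay_potential)
    show "has_quadratic_part u A"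
      using quadratic_part_delaunay_potential unfolding u B(2) .
    fix v assume "alexandrov_solution v (dirac_sum int_lattice) \<and> has_quadratic_part v A"
    then show "\<exists>c. \<forall>x. v x = u x + c"
      using alexandrov_unique[of v] unfolding u B(2) by blast
  qed
qed

end
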